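(* Let $V_{\mathbb H}^R$ and $U_{\mathbb H}^R$ be separable right quaternionic Hilbert spaces and let $A\in\mathcal B(V_{\mathbb H}^R,U_{\mathbb H}^R)$ be a Fredholm operator. Then for any compact operator $K\in\mathcal B(V_{\mathbb H}^R,U_{\mathbb H}^R)$, $A+K$ is a Fredholm operator and $\mathrm{ind}(A+K)=\mathrm{ind}(A)$.
   Context: $\mathbb H$ denotes the quaternions. A right quaternionic Hilbert space is a right $\mathbb H$-vector space, complete for the norm of an $\mathbb H$-valued inner product $\langle\cdot|\cdot\rangle$ satisfying $\overline{\langle\phi|\psi\rangle}=\langle\psi|\phi\rangle$, $\|\phi\|^2=\langle\phi|\phi\rangle>0$ for $\phi\ne0$, additivity, $\langle\phi|\psi\mathfrak q\rangle=\langle\phi|\psi\rangle\mathfrak q$ and $\langle\phi\mathfrak q|\psi\rangle=\overline{\mathfrak q}\langle\phi|\psi\rangle$. $\mathcal B(V_{\mathbb H}^R,U_{\mathbb H}^R)$ is the set of bounded right $\mathbb H$-linear operators from $V_{\mathbb H}^R$ to $U_{\mathbb H}^R$. An operator $K\in\mathcal B(V_{\mathbb H}^R,U_{\mathbb H}^R)$ is compact if the closure of the image of the closed unit ball is compact. An operator $A\in\mathcal B(V_{\mathbb H}^R,U_{\mathbb H}^R)$ is Fredholm if $\ker(A)$ and $\mathrm{coker}(A)=U_{\mathbb H}^R/\mathrm{ran}(A)$ are finite dimensional (over $\mathbb H$); its index is $\mathrm{ind}(A)=\dim\ker(A)-\dim\mathrm{coker}(A)$. *)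

theory Defs
  imports "HOL-Analysis.Analysis"
begin

section \<open>The quaternions\<close>

datatype quat = Quat (qRe: real) (qI: real) (qJ: real) (qK: real)

lemma quat_eq_iff: "p = q \<longleftrightarrow> qRe p = qRe q \<and> qI p = qI q \<and> qJ p = qJ q \<and> qK p = qK q"
  by (cases p; cases q) simp

instantiation quat :: real_div_algebra
begin

definition "0 = Quat 0 0 0 0"
definition "1 = Quat 1 0 0 0"
definition "p + q = Quat (qRe p + qRe q) (qI p + qI q) (qJ p + qJ q) (qK p + qK q)"
definition "- p = Quat (- qRe p) (- qI p) (- qJ p) (- qK p)"
definition "p - q = Quat (qRe p - qRe q) (qI p - qI q) (qJ p - qJ q) (qK p - qK q)"
definition "r *\<^sub>R p = Quat (r * qRe p) (r * qI p) (r * qJ p) (r * qK p)"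
definition
  "p * q = Quat
     (qRe p * qRe q - qI p * qI q - qJ p * qJ q - qK p * qK q)
     (qRe p * qI q + qI p * qRe q + qJ p * qK q - qK p * qJ q)
     (qRe p * qJ q - qI p * qK q + qJ p * qRe q + qK p * qI q)
     (qRe p * qK q + qI p * qJ q - qJ p * qI q + qK p * qRe q)"
definition
  "inverse p = (let n = (qRe p)\<^sup>2 + (qI p)\<^sup>2 + (qJ p)\<^sup>2 + (qK p)\<^sup>2
     in Quat (qRe p / n) (- qI p / n) (- qJ p / n) (- qK p / n))"
definition "(p::quat) div q = p * inverse q"

lemmas quat_ops = zero_quat_def one_quat_def plus_quat_def uminus_quat_def minus_quat_def
  scaleR_quat_def times_quat_def

lemma quat_norm_sq_nonzero:
  assumes "p \<noteq> 0"
  shows "(qRe p)\<^sup>2 + (qI p)\<^sup>2 + (qJ p)\<^sup>2 + (qK p)\<^sup>2 \<noteq> 0"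
proof
  assume "(qRe p)\<^sup>2 + (qI p)\<^sup>2 + (qJ p)\<^sup>2 + (qK p)\<^sup>2 = 0"
  then have "qRe p = 0 \<and> qI p = 0 \<and> qJ p = 0 \<and> qK p = 0"
    by (simp add: add_nonneg_eq_0_iff)
  with assms show False by (simp add: quat_ops quat_eq_iff)
qed

instance
proof
  fix p q r :: quat and a b :: real
  show "p * q * r = p * (q * r)"
    by (simp add: quat_ops algebra_simps)
  define n where "n = (qRe p)\<^sup>2 + (qI p)\<^sup>2 + (qJ p)\<^sup>2 + (qK p)\<^sup>2"
  have inv: "inverse p = Quat (qRe p / n) (- qI p / n) (- qJ p / n) (- qK p / n)"
    by (simp add: inverse_quat_def n_def Let_def)
  have sq: "qRe p * qRe p / n + qI p * qI p / n + qJ p * qJ p / n + qK p * qK p / n = 1"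
    if "p \<noteq> 0"
    using quat_norm_sq_nonzero[OF that]
    by (simp add: n_def power2_eq_square flip: add_divide_distrib)
  show "p \<noteq> 0 \<Longrightarrow> inverse p * p = 1"
    using sq by (simp add: quat_ops inv)
  show "p \<noteq> 0 \<Longrightarrow> p * inverse p = 1"
    using sq by (simp add: quat_ops inv)
qed (simp_all add: quat_ops divide_quat_def inverse_quat_def algebra_simps)

end

lemma quat_sel_simps [simp]:
  "qRe 0 = 0" "qI 0 = 0" "qJ 0 = 0" "qK 0 = 0"
  "qRe 1 = 1" "qI 1 = 0" "qJ 1 = 0" "qK 1 = 0"
  "qRe (p + q) = qRe p + qRe q" "qI (p + q) = qI p + qI q"
  "qJ (p + q) = qJ p + qJ q" "qK (p + q) = qK p + qK q"
  "qRe (- p) = - qRe p" "qI (- p) = - qI p" "qJ (- p) = - qJ p" "qK (- p) = - qK p"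
  "qRe (p - q) = qRe p - qRe q" "qI (p - q) = qI p - qI q"
  "qJ (p - q) = qJ p - qJ q" "qK (p - q) = qK p - qK q"
  "qRe (a *\<^sub>R p) = a * qRe p" "qI (a *\<^sub>R p) = a * qI p"
  "qJ (a *\<^sub>R p) = a * qJ p" "qK (a *\<^sub>R p) = a * qK p"
  by (simp_all add: quat_ops)

lemma quat_sel_mult:
  "qRe (p * q) = qRe p * qRe q - qI p * qI q - qJ p * qJ q - qK p * qK q"
  "qI (p * q) = qRe p * qI q + qI p * qRe q + qJ p * qK q - qK p * qJ q"
  "qJ (p * q) = qRe p * qJ q - qI p * qK q + qJ p * qRe q + qK p * qI q"
  "qK (p * q) = qRe p * qK q + qI p * qJ q - qJ p * qI q + qK p * qRe q"
  by (simp_all add: quat_ops)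

lemma quat_sel_of_real [simp]:
  "qRe (of_real a) = a" "qI (of_real a) = 0" "qJ (of_real a) = 0" "qK (of_real a) = 0"
  by (simp_all add: of_real_def)

definition qcnj :: "quat \<Rightarrow> quat"
  where "qcnj p = Quat (qRe p) (- qI p) (- qJ p) (- qK p)"

lemma qcnj_sel [simp]:
  "qRe (qcnj p) = qRe p" "qI (qcnj p) = - qI p" "qJ (qcnj p) = - qJ p" "qK (qcnj p) = - qK p"
  by (simp_all add: qcnj_def)

lemma qcnj_add: "qcnj (p + q) = qcnj p + qcnj q"
  by (simp add: quat_eq_iff)

lemma qcnj_mult: "qcnj (p * q) = qcnj q * qcnj p"
  by (simp add: quat_eq_iff quat_sel_mult)

lemma qcnj_qcnj [simp]: "qcnj (qcnj p) = p"
  by (simp add: quat_eq_iff)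

instantiation quat :: euclidean_space
begin

definition inner_quat_def:
  "inner p q = qRe p * qRe q + qI p * qI q + qJ p * qJ q + qK p * qK q"
definition norm_quat_def: "norm (p::quat) = sqrt (inner p p)"
definition sgn_quat_def: "sgn (p::quat) = p /\<^sub>R norm p"
definition dist_quat_def: "dist (p::quat) q = norm (p - q)"
definition uniformity_quat_def:
  "(uniformity :: (quat \<times> quat) filter) = (INF e\<in>{0 <..}. principal {(x, y). dist x y < e})"
definition open_quat_def:
  "open (U :: quat set) \<longleftrightarrow> (\<forall>x\<in>U. eventually (\<lambda>(x', y). x' = x \<longrightarrow> y \<in> U) uniformity)"
definition Basis_quat_def: "Basis = {1, Quat 0 1 0 0, Quat 0 0 1 0, Quat 0 0 0 1}"

instance
proof
  fix p q r :: quat and a :: real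
  show "inner p p = 0 \<longleftrightarrow> p = 0"
    by (auto simp: inner_quat_def quat_eq_iff add_nonneg_eq_0_iff)
  show "u \<in> Basis \<Longrightarrow> v \<in> Basis \<Longrightarrow> inner u v = (if u = v then 1 else 0)" for u v :: quat
    by (auto simp: Basis_quat_def inner_quat_def quat_eq_iff)
  show "(\<forall>u\<in>Basis. inner p u = 0) \<longleftrightarrow> p = 0"
    by (simp add: Basis_quat_def inner_quat_def) (simp add: quat_eq_iff)
qed (simp_all add: inner_quat_def norm_quat_def sgn_quat_def dist_quat_def uniformity_quat_def
    open_quat_def Basis_quat_def algebra_simps)

end

section \<open>Right quaternionic Hilbert spaces\<close>

text \<open>
  The real Banach space structure is not additional data: \<open>scaleR_scaleQ\<close> and
  \<open>qinner_self\<close> force real scaling to be right scaling by real quaternions and the norm to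
  be the one induced by the inner product. As the norm is positive definite, \<open>qinner_self\<close>
  also says that the inner product of a nonzero vector with itself is real and positive.
\<close>

class right_quat_hilbert = banach +
  fixes scaleQ :: "'a \<Rightarrow> quat \<Rightarrow> 'a" (infixl \<open>*\<^sub>Q\<close> 75)
    and qinner :: "'a \<Rightarrow> 'a \<Rightarrow> quat"
  assumes scaleQ_add_right: "x *\<^sub>Q (p + q) = x *\<^sub>Q p + x *\<^sub>Q q"
    and scaleQ_add_left: "(x + y) *\<^sub>Q q = x *\<^sub>Q q + y *\<^sub>Q q"
    and scaleQ_scaleQ: "x *\<^sub>Q p *\<^sub>Q q = x *\<^sub>Q (p * q)"
    and scaleQ_one [simp]: "x *\<^sub>Q 1 = x"
    and scaleR_scaleQ: "r *\<^sub>R x = x *\<^sub>Q of_real r"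
    and qcnj_qinner: "qcnj (qinner x y) = qinner y x"
    and qinner_self: "qinner x x = of_real ((norm x)\<^sup>2)"
    and qinner_add_right: "qinner x (y + z) = qinner x y + qinner x z"
    and qinner_scaleQ_right: "qinner x (y *\<^sub>Q q) = qinner x y * q"
begin

lemma qinner_add_left: "qinner (x + y) z = qinner x z + qinner y z"
  by (metis qcnj_qinner qinner_add_right qcnj_add)

lemma qinner_scaleQ_left: "qinner (x *\<^sub>Q q) y = qcnj q * qinner x y"
  by (metis qcnj_qinner qinner_scaleQ_right qcnj_mult)

lemma qinner_self_pos: "x \<noteq> 0 \<Longrightarrow> qRe (qinner x x) > 0"
  by (simp add: qinner_self del: of_real_power)

end

instantiation quat :: right_quat_hilbert
begin

definition scaleQ_quat_def: "(p::quat) *\<^sub>Q q = p * q"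
definition qinner_quat_def: "qinner (p::quat) q = qcnj p * q"

instance
proof
  fix x y z p q :: quat and r :: real
  show "qinner x x = of_real ((norm x)\<^sup>2)"
    by (simp add: qinner_quat_def norm_quat_def inner_quat_def quat_eq_iff quat_sel_mult
        algebra_simps)
qed (simp_all add: scaleQ_quat_def qinner_quat_def quat_eq_iff quat_sel_mult algebra_simps)

end

section \<open>Dimension of right vector spaces over the quaternions\<close>

text \<open>
  The library's \<open>vector_space\<close> requires commutative scalars. Carriers are explicit so that
  the same dimension applies to kernels and to quotient spaces. Families of vectors are lists;
  \<open>lincomb vs qs\<close> is meant for lists of equal length.
\<close>

locale right_quat_space =
  fixes V :: "'v set" and add :: "'v \<Rightarrow> 'v \<Rightarrow> 'v" and zero :: 'v and scale :: "'v \<Rightarrow> quat \<Rightarrow> 'v"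
  assumes add_closed: "x \<in> V \<Longrightarrow> y \<in> V \<Longrightarrow> add x y \<in> V"
    and zero_closed: "zero \<in> V"
    and scale_closed: "x \<in> V \<Longrightarrow> scale x q \<in> V"
    and add_assoc: "x \<in> V \<Longrightarrow> y \<in> V \<Longrightarrow> z \<in> V \<Longrightarrow> add (add x y) z = add x (add y z)"
    and add_commute: "x \<in> V \<Longrightarrow> y \<in> V \<Longrightarrow> add x y = add y x"
    and add_zero: "x \<in> V \<Longrightarrow> add zero x = x"
    and add_inverse: "x \<in> V \<Longrightarrow> \<exists>y\<in>V. add y x = zero"
    and scale_add_right: "x \<in> V \<Longrightarrow> scale x (p + q) = add (scale x p) (scale x q)"
    and scale_add_left: "x \<in> V \<Longrightarrow> y \<in> V \<Longrightarrow> scale (add x y) q = add (scale x q) (scale y q)"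
    and scale_scale: "x \<in> V \<Longrightarrow> scale (scale x p) q = scale x (p * q)"
    and scale_one: "x \<in> V \<Longrightarrow> scale x 1 = x"
begin

definition lincomb :: "'v list \<Rightarrow> quat list \<Rightarrow> 'v"
  where "lincomb vs qs = foldr add (map2 scale vs qs) zero"

definition span :: "'v list \<Rightarrow> 'v set"
  where "span vs = {lincomb vs qs | qs. length qs = length vs}"

definition independent :: "'v list \<Rightarrow> bool"
  where "independent vs \<longleftrightarrow>
    (\<forall>qs. length qs = length vs \<longrightarrow> lincomb vs qs = zero \<longrightarrow> (\<forall>q\<in>set qs. q = 0))"

definition basis :: "'v list \<Rightarrow> bool"
  where "basis vs \<longleftrightarrow> set vs \<subseteq> V \<and> independent vs \<and> span vs = V"

definition finite_dimensional :: bool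
  where "finite_dimensional \<longleftrightarrow> (\<exists>vs. basis vs)"

definition dim :: nat
  where "dim = (THE n. \<exists>vs. basis vs \<and> length vs = n)"

end

section \<open>Operators\<close>

definition bounded_right_linear ::
    "('v::right_quat_hilbert \<Rightarrow> 'u::right_quat_hilbert) \<Rightarrow> bool"
  where "bounded_right_linear A \<longleftrightarrow>
    (\<forall>x y. A (x + y) = A x + A y) \<and> (\<forall>x q. A (x *\<^sub>Q q) = A x *\<^sub>Q q) \<and>
    (\<exists>C. \<forall>x. norm (A x) \<le> C * norm x)"

definition compact_operator ::
    "('v::right_quat_hilbert \<Rightarrow> 'u::right_quat_hilbert) \<Rightarrow> bool"
  where "compact_operator K \<longleftrightarrow> bounded_right_linear K \<and> compact (closure (K ` cball 0 1))"

definition quot_rel :: "'u::right_quat_hilbert set \<Rightarrow> ('u \<times> 'u) set"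
  where "quot_rel W = {(x, y). x - y \<in> W}"

definition quot_carrier :: "'u::right_quat_hilbert set \<Rightarrow> 'u set set"
  where "quot_carrier W = UNIV // quot_rel W"

definition quot_add :: "'u::right_quat_hilbert set \<Rightarrow> 'u set \<Rightarrow> 'u set \<Rightarrow> 'u set"
  where "quot_add W X Y = (\<Union>x\<in>X. \<Union>y\<in>Y. quot_rel W `` {x + y})"

definition quot_zero :: "'u::right_quat_hilbert set \<Rightarrow> 'u set"
  where "quot_zero W = quot_rel W `` {0}"

definition quot_scale :: "'u::right_quat_hilbert set \<Rightarrow> 'u set \<Rightarrow> quat \<Rightarrow> 'u set"
  where "quot_scale W X q = (\<Union>x\<in>X. quot_rel W `` {x *\<^sub>Q q})"

definition ker :: "('v::right_quat_hilbert \<Rightarrow> 'u::right_quat_hilbert) \<Rightarrow> 'v set"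
  where "ker A = {x. A x = 0}"

lemma scaleQ_zero_left [simp]: "(0::'v::right_quat_hilbert) *\<^sub>Q q = 0"
  using scaleQ_add_left[of "0::'v" 0 q] by simp

lemma scaleQ_minus_left: "(- x) *\<^sub>Q q = - ((x::'v::right_quat_hilbert) *\<^sub>Q q)"
  using scaleQ_add_left[of x "- x" q] by (simp add: eq_neg_iff_add_eq_0 add.commute)

lemma scaleQ_diff_left: "(x - y) *\<^sub>Q q = (x::'v::right_quat_hilbert) *\<^sub>Q q - y *\<^sub>Q q"
  using scaleQ_add_left[of x "- y" q] by (simp add: scaleQ_minus_left)

lemma right_quat_space_ker:
  assumes "bounded_right_linear A"
  shows "right_quat_space (ker A) (+) 0 (*\<^sub>Q)"
proof -
  have add: "A (x + y) = A x + A y" and sc: "A (x *\<^sub>Q q) = A x *\<^sub>Q q" for x y q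
    using assms by (auto simp: bounded_right_linear_def)
  have zero: "A 0 = 0" using add[of 0 0] by simp
  have minus: "A (- x) = - A x" for x
    using add[of x "- x"] zero by (simp add: eq_neg_iff_add_eq_0 add.commute)
  show ?thesis
  proof
    show "\<exists>y\<in>ker A. y + x = 0" if "x \<in> ker A" for x
      using that by (intro bexI[of _ "- x"]) (auto simp: ker_def minus)
  qed (auto simp: ker_def add sc zero scaleQ_add_right scaleQ_add_left scaleQ_scaleQ
      add.assoc add.commute add.left_commute)
qed

lemma right_quat_space_quot:
  fixes W :: "'u::right_quat_hilbert set"
  assumes W0: "0 \<in> W" and Wadd: "\<And>x y. x \<in> W \<Longrightarrow> y \<in> W \<Longrightarrow> x + y \<in> W"
    and Wsc: "\<And>x q. x \<in> W \<Longrightarrow> x *\<^sub>Q q \<in> W"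
  shows "right_quat_space (quot_carrier W) (quot_add W) (quot_zero W) (quot_scale W)"
proof -
  have Wm: "- x \<in> W" if "x \<in> W" for x
  proof -
    have "- x = (- 1) *\<^sub>R x" by simp
    also have "\<dots> = x *\<^sub>Q of_real (- 1)" by (rule scaleR_scaleQ)
    finally show ?thesis using Wsc[OF that] by simp
  qed
  have Wd: "x - y \<in> W" if "x \<in> W" "y \<in> W" for x y
    using Wadd[OF that(1) Wm[OF that(2)]] by simp
  define c where "c x = quot_rel W `` {x}" for x
  have mem: "y \<in> c x \<longleftrightarrow> x - y \<in> W" for x y by (simp add: c_def quot_rel_def)
  have self: "x \<in> c x" for x unfolding mem by (simp add: W0)
  have eqI: "c x = c y" if "x - y \<in> W" for x y
  proof (rule set_eqI)
    fix z
    have "x - z \<in> W \<longleftrightarrow> y - z \<in> W"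
      using Wadd[OF that, of "y - z"] Wd[of "x - z" "x - y"] that by auto
    then show "z \<in> c x \<longleftrightarrow> z \<in> c y" unfolding mem .
  qed
  have add: "quot_add W (c x) (c y) = c (x + y)" for x y
  proof -
    have "c (x' + y') = c (x + y)" if "x' \<in> c x" "y' \<in> c y" for x' y'
    proof -
      have "(x - x') + (y - y') \<in> W" using that unfolding mem by (rule Wadd)
      then have "c (x + y) = c (x' + y')" by (intro eqI) (simp add: algebra_simps)
      then show ?thesis by simp
    qed
    with self[of x] self[of y] show ?thesis unfolding quot_add_def c_def by blast
  qed
  have sc: "quot_scale W (c x) q = c (x *\<^sub>Q q)" for x q
  proof -
    have "c (x' *\<^sub>Q q) = c (x *\<^sub>Q q)" if "x' \<in> c x" for x'
      using that[unfolded mem] Wsc[of "x - x'" q] eqI[of "x *\<^sub>Q q" "x' *\<^sub>Q q"]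
      by (simp add: scaleQ_diff_left)
    with self[of x] show ?thesis unfolding quot_scale_def c_def by blast
  qed
  have car: "quot_carrier W = range c"
    by (auto simp: quot_carrier_def quotient_def c_def)
  have zero: "quot_zero W = c 0"
    by (simp only: quot_zero_def c_def)
  show ?thesis
  proof
    show "\<exists>Y\<in>quot_carrier W. quot_add W Y X = quot_zero W" if X: "X \<in> quot_carrier W" for X
    proof -
      obtain x where x: "X = c x" using X by (auto simp: car)
      show ?thesis
        unfolding x zero car by (intro bexI[of _ "c (- x)"]) (auto simp: add)
    qed
  qed (auto simp: car add sc zero scaleQ_add_right scaleQ_add_left scaleQ_scaleQ
      add.assoc add.commute add.left_commute)
qed

lemma right_quat_space_coker:
  assumes "bounded_right_linear A"
  shows "right_quat_space (quot_carrier (range A)) (quot_add (range A)) (quot_zero (range A))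
    (quot_scale (range A))"
proof (rule right_quat_space_quot)
  have add: "A (x + y) = A x + A y" and sc: "A (x *\<^sub>Q q) = A x *\<^sub>Q q" for x y q
    using assms by (auto simp: bounded_right_linear_def)
  show "0 \<in> range A" using add[of 0 0] by (intro image_eqI[of _ _ 0]) auto
  show "x + y \<in> range A" if "x \<in> range A" "y \<in> range A" for x y
    using that by (auto simp flip: add)
  show "x *\<^sub>Q q \<in> range A" if "x \<in> range A" for x q
    using that by (auto simp flip: sc)
qed

definition ker_finite_dimensional ::
    "('v::right_quat_hilbert \<Rightarrow> 'u::right_quat_hilbert) \<Rightarrow> bool"
  where "ker_finite_dimensional A \<longleftrightarrow> right_quat_space.finite_dimensional (ker A) (+) 0 (*\<^sub>Q)"

definition dim_ker :: "('v::right_quat_hilbert \<Rightarrow> 'u::right_quat_hilbert) \<Rightarrow> nat"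
  where "dim_ker A = right_quat_space.dim (ker A) (+) 0 (*\<^sub>Q)"

definition coker_finite_dimensional ::
    "('v::right_quat_hilbert \<Rightarrow> 'u::right_quat_hilbert) \<Rightarrow> bool"
  where "coker_finite_dimensional A \<longleftrightarrow>
    right_quat_space.finite_dimensional (quot_carrier (range A)) (quot_add (range A))
      (quot_zero (range A)) (quot_scale (range A))"

definition dim_coker :: "('v::right_quat_hilbert \<Rightarrow> 'u::right_quat_hilbert) \<Rightarrow> nat"
  where "dim_coker A =
    right_quat_space.dim (quot_carrier (range A)) (quot_add (range A))
      (quot_zero (range A)) (quot_scale (range A))"

definition fredholm :: "('v::right_quat_hilbert \<Rightarrow> 'u::right_quat_hilbert) \<Rightarrow> bool"
  where "fredholm A \<longleftrightarrow>
    bounded_right_linear A \<and> ker_finite_dimensional A \<and> coker_finite_dimensional A"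

definition fredholm_index :: "('v::right_quat_hilbert \<Rightarrow> 'u::right_quat_hilbert) \<Rightarrow> int"
  where "fredholm_index A = int (dim_ker A) - int (dim_coker A)"

end

theory Submission
  imports Defs
begin

text \<open>
  A Fredholm operator \<open>A\<close> has a bounded right inverse \<open>B\<close> up to finite rank: \<open>A B = 1 - G\<close> with
  \<open>G\<close> of finite rank (\<open>bounded_parametrix\<close>). A compact operator is a norm limit of finite-rank
  operators, so \<open>K = F + S\<close> with \<open>F\<close> of finite rank and \<open>S\<close> so small that \<open>B S\<close> is a contraction.
  Then
  \<open>A + K = A (1 + B S) + (G S + F)\<close>,
  where \<open>1 + B S\<close> is bijective and \<open>G S + F\<close> has finite rank. Composition with a bijection leaves
  kernel and cokernel dimensions alone, so everything reduces to finite-rank perturbations.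

  These are handled by linear algebra. If \<open>X\<close> is a finite-dimensional subspace of the codomain
  with \<open>ran T + X\<close> everything, then \<open>ind T = dim (T -` X) - dim X\<close>
  (\<open>has_index_vimage_iff\<close>). Choosing \<open>X\<close> to contain also the range of a finite-rank operator \<open>F\<close>
  makes the right-hand side the same for \<open>T\<close> and \<open>T + F\<close>, because
  \<open>T x + F x \<in> X\<close> iff \<open>T x \<in> X\<close>.

  The analytic input consists of orthogonal projections onto finite-dimensional subspaces, which
  give both the finite-rank approximation of \<open>K\<close> and a complement of \<open>ker A\<close>, and of the open
  mapping theorem, which bounds \<open>B\<close>. It is applied to the surjection \<open>(v, u) \<mapsto> A v + Q u\<close>, where
  \<open>Q\<close> is the projection onto a complement of the range of \<open>A\<close>.
\<close>

section \<open>Linear algebra modulo a subspace\<close>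

text \<open>
  Kernels and cokernels are both subquotients \<open>S / R\<close> of a Hilbert space: \<open>ker A / {0}\<close> and
  \<open>UNIV / range A\<close>. Spanning and independence are therefore developed modulo a subspace \<open>R\<close> for
  lists of representatives, so that no quotient type or carrier enters the dimension theory.
\<close>

definition right_subspace :: "'v::right_quat_hilbert set \<Rightarrow> bool"
  where "right_subspace W \<longleftrightarrow>
    0 \<in> W \<and> (\<forall>x\<in>W. \<forall>y\<in>W. x + y \<in> W) \<and> (\<forall>x\<in>W. \<forall>q. x *\<^sub>Q q \<in> W)"

definition qcomb :: "'v::right_quat_hilbert list \<Rightarrow> quat list \<Rightarrow> 'v"
  where "qcomb vs qs = foldr (+) (map2 (*\<^sub>Q) vs qs) 0"

definition span_mod :: "'v::right_quat_hilbert set \<Rightarrow> 'v list \<Rightarrow> 'v set"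
  where "span_mod R vs = {w. \<exists>qs. length qs = length vs \<and> w - qcomb vs qs \<in> R}"

definition independent_mod :: "'v::right_quat_hilbert set \<Rightarrow> 'v list \<Rightarrow> bool"
  where "independent_mod R vs \<longleftrightarrow>
    (\<forall>qs. length qs = length vs \<longrightarrow> qcomb vs qs \<in> R \<longrightarrow> (\<forall>q\<in>set qs. q = 0))"

text \<open>
  Lists of representatives of a basis of \<open>S / R\<close>. For subspaces \<open>R \<subseteq> S\<close> the last inclusion is an
  equality, by \<open>span_mod_least\<close>.
\<close>

definition basis_mod :: "'v::right_quat_hilbert set \<Rightarrow> 'v set \<Rightarrow> 'v list \<Rightarrow> bool"
  where "basis_mod S R vs \<longleftrightarrow> set vs \<subseteq> S \<and> independent_mod R vs \<and> S \<subseteq> span_mod R vs"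

definition right_linear :: "('v::right_quat_hilbert \<Rightarrow> 'u::right_quat_hilbert) \<Rightarrow> bool"
  where "right_linear T \<longleftrightarrow> (\<forall>x y. T (x + y) = T x + T y) \<and> (\<forall>x q. T (x *\<^sub>Q q) = T x *\<^sub>Q q)"

lemma scaleQ_zero_right [simp]: "(x::'v::right_quat_hilbert) *\<^sub>Q 0 = 0"
  using scaleQ_add_right[of x 0 0] by simp

lemma scaleQ_minus_right: "(x::'v::right_quat_hilbert) *\<^sub>Q (- q) = - (x *\<^sub>Q q)"
  using scaleQ_add_right[of x q "- q"] by (simp add: eq_neg_iff_add_eq_0 add.commute)

lemma scaleQ_diff_right: "(x::'v::right_quat_hilbert) *\<^sub>Q (p - q) = x *\<^sub>Q p - x *\<^sub>Q q"
  using scaleQ_add_right[of x p "- q"] by (simp add: scaleQ_minus_right)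

lemma right_subspaceD:
  assumes "right_subspace W"
  shows "0 \<in> W"
    and "x \<in> W \<Longrightarrow> y \<in> W \<Longrightarrow> x + y \<in> W"
    and "x \<in> W \<Longrightarrow> x *\<^sub>Q q \<in> W"
    and "x \<in> W \<Longrightarrow> - x \<in> W"
    and "x \<in> W \<Longrightarrow> y \<in> W \<Longrightarrow> x - y \<in> W"
proof -
  show 1: "0 \<in> W" and 2: "x \<in> W \<Longrightarrow> y \<in> W \<Longrightarrow> x + y \<in> W"
    and 3: "x \<in> W \<Longrightarrow> x *\<^sub>Q q \<in> W" for x y q
    using assms by (auto simp: right_subspace_def)
  show 4: "x \<in> W \<Longrightarrow> - x \<in> W" for x
    using 3[of x "- 1"] by (simp add: scaleQ_minus_right)
  show "x \<in> W \<Longrightarrow> y \<in> W \<Longrightarrow> x - y \<in> W"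
    using 2[of x "- y"] 4[of y] by simp
qed

lemma right_subspace_zero: "right_subspace {0}"
  by (simp add: right_subspace_def)

lemma right_subspace_Int: "right_subspace S \<Longrightarrow> right_subspace T \<Longrightarrow> right_subspace (S \<inter> T)"
  by (simp add: right_subspace_def)

lemma qcomb_Nil [simp]: "qcomb [] qs = 0" "qcomb vs [] = 0"
  and qcomb_Cons [simp]: "qcomb (v # vs) (q # qs) = v *\<^sub>Q q + qcomb vs qs"
  by (simp_all add: qcomb_def)

lemma qcomb_append:
  "length vs = length qs \<Longrightarrow> qcomb (vs @ ws) (qs @ rs) = qcomb vs qs + qcomb ws rs"
  by (induction vs qs rule: list_induct2) (simp_all add: add.assoc)

lemma qcomb_scale: "length vs = length qs \<Longrightarrow> qcomb vs (map (\<lambda>p. p * q) qs) = qcomb vs qs *\<^sub>Q q"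
  by (induction vs qs rule: list_induct2) (simp_all add: scaleQ_add_left scaleQ_scaleQ)

lemma qcomb_zero: "qcomb vs (replicate n 0) = 0"
  by (induction vs arbitrary: n) (simp, case_tac n, simp_all)

lemma qcomb_in_subspace:
  assumes "right_subspace W" "set vs \<subseteq> W" shows "qcomb vs qs \<in> W"
  using assms(2)
proof (induction vs arbitrary: qs)
  case (Cons v vs)
  then show ?case
    by (cases qs) (auto intro!: right_subspaceD[OF assms(1)])
qed (simp add: right_subspaceD[OF assms(1)])

lemma qcomb_right_linear:
  assumes "right_linear T" shows "T (qcomb vs qs) = qcomb (map T vs) qs"
proof -
  have add: "T (x + y) = T x + T y" and sc: "T (x *\<^sub>Q q) = T x *\<^sub>Q q" for x y q
    using assms by (auto simp: right_linear_def)
  have "T 0 = 0" using add[of 0 0] by simp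
  then show ?thesis
    by (induction vs arbitrary: qs) (simp, case_tac qs, simp_all add: add sc)
qed

lemma qcomb_shift:
  assumes "length xs = length qs"
  shows "qcomb (map (\<lambda>x. x - u *\<^sub>Q c x) xs) qs =
    qcomb xs qs - u *\<^sub>Q sum_list (map2 (\<lambda>x q. c x * q) xs qs)"
  using assms
  by (induction xs qs rule: list_induct2)
    (simp_all add: scaleQ_diff_left scaleQ_add_right scaleQ_scaleQ)

lemma span_modI: "length qs = length vs \<Longrightarrow> w - qcomb vs qs \<in> R \<Longrightarrow> w \<in> span_mod R vs"
  unfolding span_mod_def by blast

lemma span_mod_Nil [simp]: "span_mod R [] = R"
  by (simp add: span_mod_def)

text \<open>The recursion over the list of generators on which the inductions below rest.\<close>

lemma span_mod_Cons: "w \<in> span_mod R (v # vs) \<longleftrightarrow> (\<exists>q. w - v *\<^sub>Q q \<in> span_mod R vs)"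
proof
  assume "w \<in> span_mod R (v # vs)"
  then show "\<exists>q. w - v *\<^sub>Q q \<in> span_mod R vs"
    by (auto simp: span_mod_def length_Suc_conv diff_diff_eq) blast
next
  assume "\<exists>q. w - v *\<^sub>Q q \<in> span_mod R vs"
  then obtain q qs where "length qs = length vs" "w - v *\<^sub>Q q - qcomb vs qs \<in> R"
    by (auto simp: span_mod_def)
  then show "w \<in> span_mod R (v # vs)"
    by (intro span_modI[of "q # qs"]) (simp_all add: diff_diff_eq)
qed

lemma right_subspace_span_mod:
  assumes R: "right_subspace R" shows "right_subspace (span_mod R vs)"
proof (induction vs)
  case (Cons v vs)
  note D = right_subspaceD[OF Cons]
  show ?case
    unfolding right_subspace_def span_mod_Cons
  proof (intro conjI ballI allI)
    show "\<exists>q. 0 - v *\<^sub>Q q \<in> span_mod R vs"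
      by (rule exI[of _ 0]) (simp add: D)
    fix x assume x: "x \<in> span_mod R (v # vs)"
    then obtain p where p: "x - v *\<^sub>Q p \<in> span_mod R vs" by (auto simp: span_mod_Cons)
    show "\<exists>p. x *\<^sub>Q q - v *\<^sub>Q p \<in> span_mod R vs" for q
      by (rule exI[of _ "p * q"])
        (use D(3)[OF p, of q] in \<open>simp add: scaleQ_diff_left scaleQ_scaleQ\<close>)
    fix y assume "y \<in> span_mod R (v # vs)"
    then obtain q where q: "y - v *\<^sub>Q q \<in> span_mod R vs" by (auto simp: span_mod_Cons)
    show "\<exists>q. x + y - v *\<^sub>Q q \<in> span_mod R vs"
      by (rule exI[of _ "p + q"]) (use D(2)[OF p q] in \<open>simp add: scaleQ_add_right algebra_simps\<close>)
  qed
qed (simp add: R)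

lemma set_subset_span_mod:
  assumes "right_subspace R" shows "set vs \<subseteq> span_mod R vs"
proof (induction vs)
  case (Cons v vs)
  note D = right_subspaceD[OF right_subspace_span_mod[OF assms, of vs]]
  have "v \<in> span_mod R (v # vs)"
    unfolding span_mod_Cons by (rule exI[of _ 1]) (simp add: D)
  moreover have "span_mod R vs \<subseteq> span_mod R (v # vs)"
    unfolding span_mod_Cons subset_iff by (auto intro!: exI[of _ 0])
  ultimately show ?case using Cons by auto
qed simp

lemma span_mod_least:
  assumes "right_subspace W" "R \<subseteq> W" "set vs \<subseteq> W" shows "span_mod R vs \<subseteq> W"
proof
  fix w assume "w \<in> span_mod R vs"
  then obtain qs where "w - qcomb vs qs \<in> W" using assms(2) by (auto simp: span_mod_def)
  from right_subspaceD(2)[OF assms(1) this qcomb_in_subspace[OF assms(1,3), of qs]]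
  show "w \<in> W" by simp
qed

lemma independent_modI:
  "(\<And>qs. length qs = length vs \<Longrightarrow> qcomb vs qs \<in> R \<Longrightarrow> \<forall>q\<in>set qs. q = 0) \<Longrightarrow> independent_mod R vs"
  unfolding independent_mod_def by blast

lemma independent_modD:
  "independent_mod R vs \<Longrightarrow> length qs = length vs \<Longrightarrow> qcomb vs qs \<in> R \<Longrightarrow> q \<in> set qs \<Longrightarrow> q = 0"
  unfolding independent_mod_def by blast

lemma independent_mod_mono: "independent_mod R vs \<Longrightarrow> Q \<subseteq> R \<Longrightarrow> independent_mod Q vs"
  unfolding independent_mod_def by blast

lemma independent_mod_Nil [simp]: "independent_mod R []"
  by (simp add: independent_mod_def)

text \<open>
  Steinitz exchange over a skew field, by induction on the generators. If some \<open>u\<close> in the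
  independent list involves the generator \<open>v\<close> with a nonzero coefficient \<open>a\<close>, then subtracting a right
  multiple of \<open>u\<close> from every other vector removes \<open>v\<close> from it. The vectors other than \<open>u\<close> stay
  independent under this change, and both lists have become shorter by one.
\<close>

lemma steinitz_mod:
  assumes R: "right_subspace R"
    and "independent_mod R us" "set us \<subseteq> span_mod R vs"
  shows "length us \<le> length vs"
  using assms(2,3)
proof (induction vs arbitrary: us)
  case Nil
  show ?case
  proof (cases us)
    case (Cons u us')
    have "qcomb us (1 # replicate (length us') 0) \<in> R"
      using Nil(2) by (simp add: Cons qcomb_zero)
    then have "(1::quat) = 0"
      using independent_modD[OF Nil(1), of "1 # replicate (length us') 0" 1] by (simp add: Cons)
    then show ?thesis by simp
  qed simp
next
  case (Cons v vs)
  let ?S = "span_mod R vs"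
  note D = right_subspaceD[OF right_subspace_span_mod[OF R, of vs]]
  show ?case
  proof (cases "set us \<subseteq> ?S")
    case True
    then show ?thesis using Cons.IH[OF Cons.prems(1)] by simp
  next
    case False
    then obtain u where u: "u \<in> set us" "u \<notin> ?S" by auto
    then obtain us1 us2 where us: "us = us1 @ u # us2" by (meson split_list)
    obtain a where a: "u - v *\<^sub>Q a \<in> ?S"
      using u(1) Cons.prems(2) by (auto simp: span_mod_Cons subset_iff)
    have a0: "a \<noteq> 0" using u(2) a by auto
    obtain b where b: "\<And>x. x \<in> set us \<Longrightarrow> x - v *\<^sub>Q b x \<in> ?S"
      using Cons.prems(2) unfolding span_mod_Cons subset_iff by metis
    define c where "c x = inverse a * b x" for x
    define f where "f x = x - u *\<^sub>Q c x" for x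
    define xs where "xs = us1 @ us2"
    have f: "f x \<in> ?S" if "x \<in> set us" for x
    proof -
      have "(x - v *\<^sub>Q b x) - (u - v *\<^sub>Q a) *\<^sub>Q c x \<in> ?S"
        by (intro D b that a)
      moreover have "v *\<^sub>Q a *\<^sub>Q c x = v *\<^sub>Q b x"
        using a0 by (simp add: scaleQ_scaleQ c_def flip: mult.assoc)
      ultimately show ?thesis by (simp add: f_def scaleQ_diff_left)
    qed
    have "independent_mod R (map f xs)"
    proof (rule independent_modI)
      fix qs assume len: "length qs = length (map f xs)" and mem: "qcomb (map f xs) qs \<in> R"
      define q1 q2 where "q1 = take (length us1) qs" and "q2 = drop (length us1) qs"
      have qs: "qs = q1 @ q2" and l: "length q1 = length us1" "length q2 = length us2"
        using len by (simp_all add: q1_def q2_def xs_def)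
      define s where "s = - sum_list (map2 (\<lambda>x q. c x * q) xs qs)"
      have "qcomb (map f xs) qs = qcomb us (q1 @ s # q2)"
        using len l unfolding f_def
        by (subst qcomb_shift)
          (simp_all add: us xs_def qs s_def qcomb_append scaleQ_diff_right scaleQ_minus_right
            scaleQ_add_right algebra_simps)
      then have "qcomb us (q1 @ s # q2) \<in> R" using mem by simp
      moreover have "length (q1 @ s # q2) = length us" using l by (simp add: us)
      ultimately have "q = 0" if "q \<in> set (q1 @ s # q2)" for q
        using independent_modD[OF Cons.prems(1) _ _ that] by blast
      then show "\<forall>q\<in>set qs. q = 0" by (simp add: qs)
    qed
    moreover have "set (map f xs) \<subseteq> ?S" using f by (auto simp: xs_def us)
    ultimately have "length (map f xs) \<le> length vs" by (rule Cons.IH)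
    then show ?thesis by (simp add: xs_def us)
  qed
qed

lemma basis_modD:
  assumes "basis_mod S R vs"
  shows "set vs \<subseteq> S" "independent_mod R vs" "S \<subseteq> span_mod R vs"
  using assms by (simp_all add: basis_mod_def)

lemma basis_mod_length_unique:
  assumes "right_subspace R" "basis_mod S R us" "basis_mod S R vs"
  shows "length us = length vs"
  using steinitz_mod[OF assms(1)] basis_modD[OF assms(2)] basis_modD[OF assms(3)]
  by (meson antisym subset_trans)

lemma independent_mod_Cons:
  assumes R: "right_subspace R" and ind: "independent_mod R us" and s: "s \<notin> span_mod R us"
  shows "independent_mod R (s # us)"
proof (rule independent_modI)
  fix qs assume len: "length qs = length (s # us)" and mem: "qcomb (s # us) qs \<in> R"
  obtain q qs' where qs: "qs = q # qs'" using len by (cases qs) auto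
  have "q = 0"
  proof (rule ccontr)
    assume q: "q \<noteq> 0"
    have "qcomb (s # us) qs *\<^sub>Q inverse q \<in> R" by (rule right_subspaceD(3)[OF R mem])
    also have "qcomb (s # us) qs *\<^sub>Q inverse q = s - qcomb us (map (\<lambda>p. p * (- inverse q)) qs')"
      using q len by (subst qcomb_scale)
        (simp_all add: qs scaleQ_add_left scaleQ_scaleQ scaleQ_minus_right)
    finally have "s \<in> span_mod R us" using len by (intro span_modI) (simp_all add: qs)
    then show False using s by contradiction
  qed
  moreover from this have "\<forall>p\<in>set qs'. p = 0"
    using independent_modD[OF ind, of qs'] mem len by (simp add: qs)
  ultimately show "\<forall>p\<in>set qs. p = 0" by (simp add: qs)
qed

text \<open>An independent list of maximal length spans, as any vector outside its span would extend it.\<close>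

lemma basis_mod_exists:
  assumes R: "right_subspace R"
    and bound: "\<And>us. independent_mod R us \<Longrightarrow> set us \<subseteq> S \<Longrightarrow> length us \<le> n"
  shows "\<exists>us. basis_mod S R us"
proof -
  let ?P = "\<lambda>k. \<exists>us. independent_mod R us \<and> set us \<subseteq> S \<and> length us = k"
  have "?P 0" by (intro exI[of _ "[]"]) simp
  moreover have "\<forall>k. ?P k \<longrightarrow> k \<le> n" using bound by blast
  ultimately obtain k where k: "?P k" "\<And>m. ?P m \<Longrightarrow> m \<le> k"
    using GreatestI_nat[of ?P 0 n] Greatest_le_nat[of ?P _ n] by blast
  then obtain us where us: "independent_mod R us" "set us \<subseteq> S" "length us = k" by auto
  have "s \<in> span_mod R us" if "s \<in> S" for s
  proof (rule ccontr)
    assume "s \<notin> span_mod R us"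
    then have "?P (Suc k)"
      using independent_mod_Cons[OF R us(1)] us that by (intro exI[of _ "s # us"]) auto
    then show False using k(2)[of "Suc k"] by simp
  qed
  then show ?thesis using us by (auto simp: basis_mod_def)
qed

lemma basis_mod_sub:
  assumes R: "right_subspace R" and vs: "basis_mod S R vs" and "M \<subseteq> S"
  shows "\<exists>us. basis_mod M R us"
proof (rule basis_mod_exists[OF R])
  fix us assume "independent_mod R us" "set us \<subseteq> M"
  then show "length us \<le> length vs"
    using steinitz_mod[OF R] basis_modD(3)[OF vs] assms(3) by blast
qed

lemma basis_mod_quotient:
  assumes R: "right_subspace R" and M: "right_subspace M" and vs: "basis_mod S R vs"
    and "R \<subseteq> M"
  shows "\<exists>us. basis_mod S M us"
proof (rule basis_mod_exists[OF M])
  fix us assume us: "independent_mod M us" "set us \<subseteq> S"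
  show "length us \<le> length vs"
    using steinitz_mod[OF R independent_mod_mono[OF us(1) assms(4)]] us(2)
      basis_modD(3)[OF vs] by blast
qed

text \<open>
  Additivity of dimension in a tower \<open>R \<subseteq> M \<subseteq> S\<close>. With
  \<open>basis_mod_length_unique\<close> it yields every dimension count below.
\<close>

lemma basis_mod_append:
  assumes M: "right_subspace M" and RM: "R \<subseteq> M" and MS: "M \<subseteq> S"
    and us: "basis_mod M R us" and vs: "basis_mod S M vs"
  shows "basis_mod S R (us @ vs)"
  unfolding basis_mod_def
proof (intro conjI independent_modI subsetI)
  show "w \<in> S" if "w \<in> set (us @ vs)" for w
    using that MS basis_modD(1)[OF us] basis_modD(1)[OF vs] by auto
next
  fix qs assume len: "length qs = length (us @ vs)" and mem: "qcomb (us @ vs) qs \<in> R"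
  define p q where "p = take (length us) qs" and "q = drop (length us) qs"
  have qs: "qs = p @ q" and l: "length p = length us" "length q = length vs"
    using len by (simp_all add: p_def q_def)
  have sum: "qcomb us p + qcomb vs q \<in> R" using mem l by (simp add: qs qcomb_append)
  have "(qcomb us p + qcomb vs q) - qcomb us p \<in> M"
    using sum RM by (intro right_subspaceD(5)[OF M] qcomb_in_subspace[OF M basis_modD(1)[OF us]]) auto
  then have q0: "\<forall>r\<in>set q. r = 0"
    using independent_modD[OF basis_modD(2)[OF vs] l(2)] by simp
  then have "q = replicate (length q) 0" by (metis replicate_length_same)
  then have "qcomb vs q = 0" by (metis qcomb_zero)
  then have "\<forall>r\<in>set p. r = 0"
    using independent_modD[OF basis_modD(2)[OF us] l(1)] sum by simp
  with q0 show "\<forall>r\<in>set qs. r = 0" by (auto simp: qs)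
next
  fix w assume "w \<in> S"
  then obtain q where q: "length q = length vs" "w - qcomb vs q \<in> M"
    using basis_modD(3)[OF vs] by (auto simp: span_mod_def)
  then obtain p where p: "length p = length us" "w - qcomb vs q - qcomb us p \<in> R"
    using basis_modD(3)[OF us] by (auto simp: span_mod_def)
  then show "w \<in> span_mod R (us @ vs)"
    using q by (intro span_modI[of "p @ q"]) (simp_all add: qcomb_append algebra_simps)
qed

lemma right_linearD:
  assumes "right_linear T"
  shows "T (x + y) = T x + T y" "T (x *\<^sub>Q q) = T x *\<^sub>Q q" "T 0 = 0" "T (- x) = - T x"
    "T (x - y) = T x - T y"
proof -
  show add: "T (x + y) = T x + T y" and sc: "T (x *\<^sub>Q q) = T x *\<^sub>Q q" for x y q
    using assms by (auto simp: right_linear_def)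
  show "T 0 = 0" using add[of 0 0] by simp
  show minus: "T (- x) = - T x" for x
    using sc[of x "- 1"] by (simp add: scaleQ_minus_right)
  show "T (x - y) = T x - T y" using add[of x "- y"] minus by simp
qed

lemma right_subspace_ker: "right_linear T \<Longrightarrow> right_subspace (ker T)"
  by (simp add: right_subspace_def ker_def right_linearD)

lemma right_subspace_range:
  assumes "right_linear T" shows "right_subspace (range T)"
  unfolding right_subspace_def
proof (intro conjI ballI allI)
  show "0 \<in> range T" using right_linearD(3)[OF assms] by (metis rangeI)
  show "x + y \<in> range T" if "x \<in> range T" "y \<in> range T" for x y
    using that by (auto simp flip: right_linearD(1)[OF assms])
  show "x *\<^sub>Q q \<in> range T" if "x \<in> range T" for x q
    using that by (auto simp flip: right_linearD(2)[OF assms])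
qed

lemma list_in_image_lift: "set ys \<subseteq> f ` S \<Longrightarrow> \<exists>xs. ys = map f xs \<and> set xs \<subseteq> S"
proof (induction ys)
  case (Cons y ys)
  then obtain x xs where "y = f x" "x \<in> S" "ys = map f xs" "set xs \<subseteq> S" by auto
  then show ?case by (intro exI[of _ "x # xs"]) simp
qed simp

text \<open>The isomorphism \<open>S / ker T \<cong> T ` S\<close>, read from right to left.\<close>

lemma basis_mod_image:
  assumes T: "right_linear T" and us: "basis_mod (T ` S) {0} (map T us)" and "set us \<subseteq> S"
  shows "basis_mod S (ker T) us"
proof -
  have mem: "w - qcomb us qs \<in> ker T \<longleftrightarrow> T w - qcomb (map T us) qs \<in> {0}" for w qs
    by (simp add: ker_def right_linearD(5)[OF T] qcomb_right_linear[OF T])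
  have "independent_mod (ker T) us"
    using basis_modD(2)[OF us] unfolding independent_mod_def
    by (simp add: ker_def qcomb_right_linear[OF T])
  moreover have "S \<subseteq> span_mod (ker T) us"
    using basis_modD(3)[OF us] unfolding span_mod_def mem by auto
  ultimately show ?thesis using assms(3) by (simp add: basis_mod_def)
qed

text \<open>The isomorphism \<open>X / (X \<inter> R) \<cong> (X + R) / R\<close> when \<open>X + R\<close> is the whole space.\<close>

lemma basis_mod_second_iso:
  assumes R: "right_subspace R" and us: "basis_mod X (X \<inter> R) us" and X: "right_subspace X"
    and full: "\<And>u. \<exists>x\<in>X. u - x \<in> R"
  shows "basis_mod UNIV R us"
  unfolding basis_mod_def
proof (intro conjI independent_modI subsetI)
  fix qs assume len: "length qs = length us" and "qcomb us qs \<in> R"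
  moreover have "qcomb us qs \<in> X" by (rule qcomb_in_subspace[OF X basis_modD(1)[OF us]])
  ultimately show "\<forall>q\<in>set qs. q = 0"
    using independent_modD[OF basis_modD(2)[OF us] len] by simp
next
  fix u
  obtain x where x: "x \<in> X" "u - x \<in> R" using full by blast
  then obtain qs where qs: "length qs = length us" "x - qcomb us qs \<in> X \<inter> R"
    using basis_modD(3)[OF us] by (auto simp: span_mod_def)
  have "(u - x) + (x - qcomb us qs) \<in> R"
    using x qs by (intro right_subspaceD(2)[OF R]) auto
  then show "u \<in> span_mod R us" using qs(1) by (intro span_modI) auto
qed simp

lemma basis_mod_span_mod:
  assumes R: "right_subspace R" shows "\<exists>us. basis_mod (span_mod R vs) R us"
  by (rule basis_mod_exists[OF R]) (rule steinitz_mod[OF R])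

section \<open>The index under finite-rank perturbations\<close>

text \<open>
  A relation instead of a function: it also asserts that kernel and cokernel are finite
  dimensional, so one statement carries both halves of the stability result.
\<close>

definition has_index :: "('v::right_quat_hilbert \<Rightarrow> 'u::right_quat_hilbert) \<Rightarrow> int \<Rightarrow> bool"
  where "has_index T n \<longleftrightarrow> (\<exists>us vs. basis_mod (ker T) {0} us \<and> basis_mod UNIV (range T) vs \<and>
    n = int (length us) - int (length vs))"

text \<open>
  Put \<open>Y = T -` X\<close>. Then \<open>Y / ker T \<cong> X \<inter> ran T\<close> and
  \<open>X / (X \<inter> ran T) \<cong> coker T\<close>, so
  \<open>dim Y - dim X = dim (ker T) - dim (coker T)\<close> with \<open>dim (X \<inter> ran T)\<close> cancelling.
\<close>

lemma has_index_vimage_iff: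
  assumes T: "right_linear T" and X: "right_subspace X"
    and full: "\<And>u. \<exists>x\<in>X. u - x \<in> range T"
    and xs: "basis_mod X {0} xs"
  shows "has_index T n \<longleftrightarrow>
    (\<exists>ys. basis_mod (T -` X) {0} ys \<and> n = int (length ys) - int (length xs))"
proof -
  note sub = right_subspace_zero right_subspace_ker[OF T] right_subspace_range[OF T] X
  have z: "{0} \<subseteq> X \<inter> range T" "{0} \<subseteq> ker T" "ker T \<subseteq> T -` X" "T ` (T -` X) = X \<inter> range T"
    using right_subspaceD(1)[OF sub(3)] right_subspaceD(1)[OF X] by (auto simp: ker_def right_linearD(3)[OF T])
  have XR: "right_subspace (X \<inter> range T)" using sub by (simp add: right_subspace_Int)
  obtain ms where ms: "basis_mod (X \<inter> range T) {0} ms"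
    using basis_mod_sub[OF sub(1) xs, of "X \<inter> range T"] by auto
  obtain cs where cs: "basis_mod X (X \<inter> range T) cs"
    using basis_mod_quotient[OF sub(1) XR xs z(1)] by auto
  have xlen: "length xs = length ms + length cs"
    using basis_mod_length_unique[OF sub(1) xs basis_mod_append[OF XR z(1) _ ms cs]] by simp
  have coker: "basis_mod UNIV (range T) cs"
    by (rule basis_mod_second_iso[OF sub(3) cs X full])
  have "set ms \<subseteq> T ` (T -` X)" using basis_modD(1)[OF ms] z(4) by simp
  then obtain ls where ls: "ms = map T ls" "set ls \<subseteq> T -` X"
    using list_in_image_lift by blast
  have quot: "basis_mod (T -` X) (ker T) ls"
    using basis_mod_image[OF T, of "T -` X" ls] ms ls z(4) by simp
  have append: "basis_mod (T -` X) {0} (ks @ ls)" if "basis_mod (ker T) {0} ks" for ks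
    using basis_mod_append[OF sub(2) z(2,3) that quot] .
  show ?thesis
  proof
    assume "has_index T n"
    then obtain us vs where "basis_mod (ker T) {0} us" "basis_mod UNIV (range T) vs"
      "n = int (length us) - int (length vs)" by (auto simp: has_index_def)
    moreover from this have "length vs = length cs"
      using basis_mod_length_unique[OF sub(3) _ coker] by simp
    ultimately show "\<exists>ys. basis_mod (T -` X) {0} ys \<and> n = int (length ys) - int (length xs)"
      using append by (intro exI[of _ "us @ ls"]) (simp add: xlen ls)
  next
    assume "\<exists>ys. basis_mod (T -` X) {0} ys \<and> n = int (length ys) - int (length xs)"
    then obtain ys where ys: "basis_mod (T -` X) {0} ys" "n = int (length ys) - int (length xs)"
      by auto
    obtain ks where ks: "basis_mod (ker T) {0} ks"
      using basis_mod_sub[OF sub(1) ys(1) z(3)] by auto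
    have "length ys = length ks + length ls"
      using basis_mod_length_unique[OF sub(1) ys(1) append[OF ks]] by simp
    then show "has_index T n"
      using ks coker ys(2) xlen ls(1) unfolding has_index_def by force
  qed
qed

lemma right_linear_add: "right_linear S \<Longrightarrow> right_linear T \<Longrightarrow> right_linear (\<lambda>x. S x + T x)"
  by (simp add: right_linear_def scaleQ_add_left)

text \<open>
  One subspace \<open>X\<close>, spanned by a complement of \<open>ran T\<close> and the range of \<open>F\<close>, computes the index
  of \<open>T\<close> and of \<open>T + F\<close>, and its preimage under the two maps is the same.
\<close>

lemma has_index_finite_rank_perturbation:
  assumes T: "right_linear T" and F: "right_linear F" and ran: "range F \<subseteq> span_mod {0} fs"
    and ind: "has_index T n"
  shows "has_index (\<lambda>x. T x + F x) n"
proof -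
  obtain vs where vs: "basis_mod UNIV (range T) vs" using ind by (auto simp: has_index_def)
  define X where "X = span_mod {0} (vs @ fs)"
  have X: "right_subspace X" by (simp add: X_def right_subspace_span_mod right_subspace_zero)
  obtain xs where xs: "basis_mod X {0} xs"
    unfolding X_def using basis_mod_span_mod[OF right_subspace_zero] by blast
  have mem: "set (vs @ fs) \<subseteq> X" unfolding X_def by (rule set_subset_span_mod[OF right_subspace_zero])
  then have FX: "F x \<in> X" for x
    using span_mod_least[OF X, of "{0}" fs] ran right_subspaceD(1)[OF X] by auto
  have fullT: "\<exists>x\<in>X. u - x \<in> range T" for u
  proof -
    obtain qs where "u - qcomb vs qs \<in> range T"
      using basis_modD(3)[OF vs] unfolding span_mod_def by blast
    moreover have "qcomb vs qs \<in> X" using mem by (intro qcomb_in_subspace[OF X]) auto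
    ultimately show ?thesis by blast
  qed
  have full: "\<exists>x\<in>X. u - x \<in> range (\<lambda>x. T x + F x)" for u
  proof -
    obtain x w where x: "x \<in> X" "u - x = T w" using fullT[of u] by auto
    then have "x - F w \<in> X" "u - (x - F w) = T w + F w"
      using right_subspaceD(5)[OF X x(1) FX] by (auto simp: algebra_simps)
    then show ?thesis by blast
  qed
  have "T x + F x \<in> X \<longleftrightarrow> T x \<in> X" for x
    using right_subspaceD(2)[OF X _ FX[of x], of "T x"]
      right_subspaceD(5)[OF X _ FX[of x], of "T x + F x"] by auto
  then have eq: "(\<lambda>x. T x + F x) -` X = T -` X" by auto
  show ?thesis
    using ind unfolding has_index_vimage_iff[OF T X fullT xs]
      has_index_vimage_iff[OF right_linear_add[OF T F] X full xs] eq .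
qed

lemma has_index_comp_bij:
  assumes T: "right_linear T" and J: "right_linear J" "bij J" and ind: "has_index T n"
  shows "has_index (\<lambda>x. T (J x)) n"
proof -
  obtain us vs where us: "basis_mod (ker T) {0} us" and vs: "basis_mod UNIV (range T) vs"
    and n: "n = int (length us) - int (length vs)" using ind by (auto simp: has_index_def)
  have ran: "range (\<lambda>x. T (J x)) = range T"
    using bij_is_surj[OF J(2)] by (metis image_image)
  have ker0: "ker J = {0}"
    using bij_is_inj[OF J(2)] right_linearD(3)[OF J(1)] unfolding ker_def inj_def by auto
  define ws where "ws = map (inv J) us"
  have us': "us = map J ws"
    using bij_is_surj[OF J(2)] by (simp add: ws_def surj_iff)
  have img: "J ` ker (\<lambda>x. T (J x)) = ker T"
    using bij_is_surj[OF J(2)] by (auto simp: ker_def surj_def) 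
  have "set ws \<subseteq> ker (\<lambda>x. T (J x))"
    using basis_modD(1)[OF us] by (auto simp: us' ker_def)
  then have "basis_mod (ker (\<lambda>x. T (J x))) {0} ws"
    using basis_mod_image[OF J(1), of "ker (\<lambda>x. T (J x))" ws] us
    by (simp add: img us' ker0)
  then show ?thesis
    using vs n unfolding has_index_def ran by (auto simp: us')
qed

section \<open>Orthogonal projections onto finite-dimensional subspaces\<close>

lemma qinner_zero_right [simp]: "qinner x (0::'v::right_quat_hilbert) = 0"
  using qinner_add_right[of x 0 0] by simp

lemma qinner_diff_right: "qinner x (y - z) = qinner x y - qinner (x::'v::right_quat_hilbert) z"
  using qinner_add_right[of x "y - z" z] by simp

lemma qinner_commute_zero: "qinner x y = 0 \<Longrightarrow> qinner y (x::'v::right_quat_hilbert) = 0"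
  using qcnj_qinner[of x y] by (simp add: quat_eq_iff)

lemma norm_add_orthogonal:
  fixes x y :: "'v::right_quat_hilbert"
  assumes "qinner x y = 0" shows "(norm (x + y))\<^sup>2 = (norm x)\<^sup>2 + (norm y)\<^sup>2"
proof -
  have "qinner (x + y) (x + y) = qinner x x + qinner y y"
    using assms qinner_commute_zero[OF assms] by (simp add: qinner_add_left qinner_add_right)
  then have "of_real ((norm (x + y))\<^sup>2) = (of_real ((norm x)\<^sup>2 + (norm y)\<^sup>2) :: quat)"
    unfolding qinner_self of_real_add .
  then show ?thesis by (simp only: of_real_eq_iff)
qed

definition orthogonal_projection ::
    "('v::right_quat_hilbert \<Rightarrow> 'v) \<Rightarrow> 'v set \<Rightarrow> bool"
  where "orthogonal_projection P W \<longleftrightarrow>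
    right_linear P \<and> range P \<subseteq> W \<and> (\<forall>x. \<forall>y\<in>W. qinner y (x - P x) = 0)"

text \<open>
  Gram-Schmidt: the residual \<open>w\<close> of a new vector is orthogonal to the span so far, and the
  projection is enlarged by the component along \<open>w\<close>.
\<close>

lemma orthogonal_projection_span_exists:
  "\<exists>P. orthogonal_projection P (span_mod {0} vs)"
proof (induction vs)
  case Nil
  have "orthogonal_projection (\<lambda>x::'a. 0) {0}"
    by (simp add: orthogonal_projection_def right_linear_def qinner_commute_zero)
  then show ?case by auto
next
  case (Cons v vs)
  let ?S = "span_mod {0} vs" and ?S' = "span_mod {0} (v # vs)"
  from Cons obtain P where P: "right_linear P" "range P \<subseteq> ?S"
    "\<And>x y. y \<in> ?S \<Longrightarrow> qinner y (x - P x) = 0"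
    by (auto simp: orthogonal_projection_def)
  note D = right_subspaceD[OF right_subspace_span_mod[OF right_subspace_zero, of vs]]
  note D' = right_subspaceD[OF right_subspace_span_mod[OF right_subspace_zero, of "v # vs"]]
  define w where "w = v - P v"
  \<comment> \<open>If \<open>w = 0\<close>, the convention \<open>inverse 0 = 0\<close> makes the new term vanish, as it should.\<close>
  define Q where "Q x = P x + w *\<^sub>Q (of_real (inverse ((norm w)\<^sup>2)) * qinner w x)" for x
  have Pmem: "P x \<in> ?S" for x using P(2) by auto
  have w_orth: "qinner y w = 0" "qinner w y = 0" if "y \<in> ?S" for y
    using P(3)[OF that, of v] qinner_commute_zero by (auto simp: w_def)
  have "right_linear Q"
    unfolding right_linear_def Q_def
    by (simp add: right_linearD[OF P(1)] qinner_add_right qinner_scaleQ_right scaleQ_add_right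
      scaleQ_add_left scaleQ_scaleQ mult.assoc distrib_left del: of_real_inverse)
  moreover have "Q x \<in> ?S'" for x
  proof -
    have sub: "?S \<subseteq> ?S'"
      unfolding span_mod_Cons subset_iff by (auto intro!: exI[of _ 0])
    have "v \<in> ?S'" using set_subset_span_mod[OF right_subspace_zero, of "v # vs"] by simp
    then have "w \<in> ?S'" unfolding w_def using sub Pmem[of v] by (intro D') auto
    then show ?thesis unfolding Q_def using sub Pmem[of x] by (intro D') auto
  qed
  moreover have "qinner y (x - Q x) = 0" if y': "y \<in> ?S'" for x y
  proof -
    obtain q where q: "y - v *\<^sub>Q q \<in> ?S" using y' unfolding span_mod_Cons by blast
    define z where "z = (y - v *\<^sub>Q q) + P v *\<^sub>Q q"
    have z: "z \<in> ?S" unfolding z_def by (intro D q Pmem)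
    have y: "y = w *\<^sub>Q q + z" by (simp add: w_def z_def scaleQ_diff_left)
    have "qinner z (x - Q x) = qinner z (x - P x) - qinner z w * (of_real (inverse ((norm w)\<^sup>2)) * qinner w x)"
      by (simp add: Q_def qinner_diff_right qinner_add_right qinner_scaleQ_right)
    then have 1: "qinner z (x - Q x) = 0" using P(3)[OF z] w_orth[OF z] by simp
    have "qinner w w * (of_real (inverse ((norm w)\<^sup>2)) * qinner w x) = qinner w x"
    proof (cases "w = 0")
      case True
      have "qinner w x = 0" unfolding True by (rule qinner_commute_zero) simp
      then show ?thesis by simp
    next
      case False
      then have "qinner w w * of_real (inverse ((norm w)\<^sup>2)) = 1"
        unfolding qinner_self of_real_mult[symmetric] by simp
      then show ?thesis by (simp flip: mult.assoc)
    qed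
    then have "qinner w (x - Q x) = 0"
      using w_orth(2)[OF Pmem[of x]]
      by (simp add: Q_def qinner_diff_right qinner_add_right qinner_scaleQ_right)
    then show ?thesis using 1 by (simp add: y qinner_add_left qinner_scaleQ_left)
  qed
  ultimately show ?case by (auto simp: orthogonal_projection_def)
qed

text \<open>By Pythagoras, \<open>P x\<close> is a best approximation of \<open>x\<close> in \<open>W\<close>.\<close>

lemma orthogonal_projection_closest:
  assumes P: "orthogonal_projection P W" and W: "right_subspace W" and y: "y \<in> W"
  shows "norm (x - P x) \<le> norm (x - y)"
proof -
  have "P x - y \<in> W"
    using P y by (intro right_subspaceD(5)[OF W]) (auto simp: orthogonal_projection_def)
  then have "qinner (P x - y) (x - P x) = 0"
    using P by (auto simp: orthogonal_projection_def)
  then have "(norm (x - y))\<^sup>2 = (norm (P x - y))\<^sup>2 + (norm (x - P x))\<^sup>2"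
    using norm_add_orthogonal[of "P x - y" "x - P x"] by simp
  then have "(norm (x - P x))\<^sup>2 \<le> (norm (x - y))\<^sup>2" by simp
  then show ?thesis by (rule power2_le_imp_le) simp
qed

lemma orthogonal_projection_fixes:
  assumes "orthogonal_projection P W" "right_subspace W" "y \<in> W"
  shows "P y = y"
  using orthogonal_projection_closest[OF assms, of y] by simp

lemma orthogonal_projection_bounded:
  assumes "orthogonal_projection P W" "right_subspace W"
  shows "norm (x - P x) \<le> norm x" "norm (P x) \<le> 2 * norm x"
proof -
  show 1: "norm (x - P x) \<le> norm x"
    using orthogonal_projection_closest[OF assms right_subspaceD(1)[OF assms(2)], of x] by simp
  show "norm (P x) \<le> 2 * norm x"
    using norm_triangle_ineq4[of x "x - P x"] 1 by simp
qed

section \<open>The open mapping theorem\<close>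

text \<open>
  The Baire category argument: the closures of the images of the balls of radius \<open>n\<close> cover the
  codomain, so one of them contains a ball. Differences of its points approximate every
  vector near the origin, and rescaling gives approximate solutions of \<open>T x = y\<close> with a linear bound.
\<close>

lemma surj_approximate_preimage:
  fixes T :: "'a::banach \<Rightarrow> 'b::banach"
  assumes T: "bounded_linear T" and surj: "surj T"
  shows "\<exists>M\<ge>0. \<forall>y. \<exists>x. norm x \<le> M * norm y \<and> norm (y - T x) \<le> norm y / 2"
proof -
  interpret bounded_linear T by (rule T)
  let ?C = "\<lambda>n::nat. closure (T ` ball 0 (real n))"
  have "(\<Union>n. ?C n) = UNIV"
  proof (intro set_eqI iffI UNIV_I)
    fix y
    obtain x where x: "y = T x" using surj by (metis surjD)
    obtain n :: nat where "norm x < real n" using reals_Archimedean2 by blast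
    then have "y \<in> T ` ball 0 (real n)" by (simp add: x)
    then have "y \<in> ?C n" by (rule subsetD[OF closure_subset])
    then show "y \<in> (\<Union>n. ?C n)" by (rule UN_I[OF UNIV_I])
  qed
  then have full: "interior (\<Union>(range ?C)) \<noteq> {}" by (simp only: interior_UNIV) simp
  have int: "euclidean interior_of S = interior S" for S :: "'b set"
    by (auto simp: interior_of_def interior_def)
  have "\<exists>n. interior (?C n) \<noteq> {}"
  proof (rule ccontr)
    assume "\<not> ?thesis"
    then have "euclidean interior_of \<Union>(range ?C) = {}"
      using completely_metrizable_space_euclidean
      by (intro Baire_category_alt) (auto simp: int)
    then show False using full by (simp only: int)
  qed
  then obtain n y0 where "y0 \<in> interior (?C n)" by auto
  then obtain e where e: "e > 0" "ball y0 e \<subseteq> ?C n" by (meson mem_interior)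
  have near: "\<exists>x. norm x \<le> 2 * real n \<and> norm (y - T x) < d" if y: "norm y < e" and d: "d > 0" for y d
  proof -
    have "y0 + y \<in> ?C n" "y0 \<in> ?C n" using e y by (auto simp: dist_norm subset_iff)
    then obtain a b where a: "norm a < real n" "norm (y0 + y - T a) < d / 2"
      and b: "norm b < real n" "norm (y0 - T b) < d / 2"
      using d unfolding closure_approachable
      by (auto simp: dist_norm norm_minus_commute dest!: spec[of _ "d / 2"])
    have "y - T (a - b) = (y0 + y - T a) - (y0 - T b)" by (simp add: diff)
    then have "norm (y - T (a - b)) \<le> norm (y0 + y - T a) + norm (y0 - T b)"
      by (simp only: norm_triangle_ineq4)
    then have "norm (y - T (a - b)) < d" using a(2) b(2) by simp
    moreover have "norm (a - b) \<le> 2 * real n" using norm_triangle_ineq4[of a b] a b by simp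
    ultimately show ?thesis by blast
  qed
  show ?thesis
  proof (intro exI[of _ "4 * real n / e"] conjI allI)
    show "0 \<le> 4 * real n / e" using e by simp
    fix y
    show "\<exists>x. norm x \<le> 4 * real n / e * norm y \<and> norm (y - T x) \<le> norm y / 2"
    proof (cases "y = 0")
      case True
      then show ?thesis by (intro exI[of _ 0]) (simp add: zero)
    next
      case False
      define r where "r = e / (2 * norm y)"
      have r: "r > 0" using e False by (simp add: r_def)
      have "norm (r *\<^sub>R y) < e" using e False by (simp add: r_def)
      from near[OF this, of "e / 4"] e obtain x
        where x: "norm x \<le> 2 * real n" "norm (r *\<^sub>R y - T x) < e / 4" by auto
      have "norm (y - T ((1/r) *\<^sub>R x)) = (1/r) * norm (r *\<^sub>R y - T x)"
      proof -
        have "y - T ((1/r) *\<^sub>R x) = (1/r) *\<^sub>R (r *\<^sub>R y - T x)"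
          using r by (simp add: scaleR scaleR_diff_right)
        then show ?thesis using r by simp
      qed
      also have "\<dots> \<le> (1/r) * (e / 4)" using x r by (intro mult_left_mono) auto
      also have "\<dots> = norm y / 2" using e False by (simp add: r_def field_simps)
      finally have "norm (y - T ((1/r) *\<^sub>R x)) \<le> norm y / 2" .
      moreover have "norm ((1/r) *\<^sub>R x) \<le> (1/r) * (2 * real n)"
        using x r by (simp add: divide_right_mono)
      then have "norm ((1/r) *\<^sub>R x) \<le> 4 * real n / e * norm y"
        by (simp add: r_def field_simps)
      ultimately show ?thesis by blast
    qed
  qed
qed

text \<open>
  Solving approximately for the remaining error again and again halves it each time; the corrections
  form a geometrically convergent series whose sum is an exact solution.
\<close>

lemma surj_bounded_preimage:
  fixes T :: "'a::banach \<Rightarrow> 'b::banach"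
  assumes T: "bounded_linear T" and surj: "surj T"
  shows "\<exists>M. \<forall>y. \<exists>x. T x = y \<and> norm x \<le> M * norm y"
proof -
  interpret bounded_linear T by (rule T)
  obtain M g where M: "M \<ge> 0" and g: "\<And>y. norm (g y) \<le> M * norm y"
    and rest: "\<And>y. norm (y - T (g y)) \<le> norm y / 2"
    using surj_approximate_preimage[OF assms] by metis
  have "\<exists>x. T x = y \<and> norm x \<le> 2 * M * norm y" for y
  proof -
    define r where "r k = ((\<lambda>z. z - T (g z)) ^^ k) y" for k
    have r0: "r 0 = y" and rS: "r (Suc k) = r k - T (g (r k))" for k by (simp_all add: r_def)
    have rn: "norm (r k) \<le> norm y * (1/2) ^ k" for k
    proof (induction k)
      case (Suc k)
      then show ?case using rest[of "r k"] by (simp add: rS)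
    qed (simp add: r0)
    have gn: "norm (g (r k)) \<le> M * norm y * (1/2) ^ k" for k
      using order_trans[OF g mult_left_mono[OF rn M]] by (simp add: mult.assoc)
    have sm: "(\<lambda>k. M * norm y * (1/2) ^ k) sums (M * norm y * 2)"
      using sums_mult[OF geometric_sums[of "1/2::real"], of "M * norm y"] by simp
    have nsum: "summable (\<lambda>k. norm (g (r k)))"
      by (rule summable_comparison_test[OF _ sums_summable[OF sm]]) (use gn in auto)
    define x where "x = (\<Sum>k. g (r k))"
    have "norm x \<le> (\<Sum>k. norm (g (r k)))" unfolding x_def by (rule summable_norm[OF nsum])
    also have "\<dots> \<le> M * norm y * 2"
      using suminf_le[OF gn nsum sums_summable[OF sm]] sums_unique[OF sm] by simp
    finally have 1: "norm x \<le> 2 * M * norm y" by (simp add: mult_ac)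
    have "(\<lambda>k. T (g (r k))) sums T x"
      unfolding x_def by (rule sums[OF summable_sums[OF summable_norm_cancel[OF nsum]]])
    moreover have "r \<longlonglongrightarrow> 0"
    proof (rule Lim_null_comparison)
      show "\<forall>\<^sub>F k in sequentially. norm (r k) \<le> norm y * (1/2) ^ k" using rn by simp
      show "(\<lambda>k. norm y * (1/2) ^ k) \<longlonglongrightarrow> 0"
        by (rule tendsto_mult_right_zero) (rule LIMSEQ_power_zero, simp)
    qed
    then have "(\<lambda>k. r k - r (Suc k)) sums (r 0 - 0)" by (rule telescope_sums')
    ultimately have "T x = y" using sums_unique2 by (simp add: rS r0) blast
    with 1 show ?thesis by blast
  qed
  then show ?thesis by blast
qed

section \<open>Reduction of compact to finite-rank perturbations\<close>

lemma bounded_right_linear_iff: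
  "bounded_right_linear A \<longleftrightarrow> right_linear A \<and> (\<exists>C. \<forall>x. norm (A x) \<le> C * norm x)"
  by (simp add: bounded_right_linear_def right_linear_def)

lemma right_linear_compose: "right_linear S \<Longrightarrow> right_linear T \<Longrightarrow> right_linear (\<lambda>x. S (T x))"
  by (simp add: right_linear_def)

lemma right_linear_scaleR: "right_linear T \<Longrightarrow> T (r *\<^sub>R x) = r *\<^sub>R T x"
  by (simp add: scaleR_scaleQ right_linearD(2))

lemma bounded_right_linear_imp_bounded_linear:
  assumes "bounded_right_linear A" shows "bounded_linear A"
proof -
  obtain C where "right_linear A" "\<And>x. norm (A x) \<le> C * norm x"
    using assms by (auto simp: bounded_right_linear_iff)
  then show ?thesis
    by (intro bounded_linear_intro[of A C])
      (simp_all add: right_linearD(1) right_linear_scaleR mult.commute)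
qed

text \<open>Solving \<open>x + S x = y\<close> means finding a fixed point of the contraction \<open>x \<mapsto> y - S x\<close>.\<close>

lemma bij_id_plus_contraction:
  fixes S :: "'v::right_quat_hilbert \<Rightarrow> 'v"
  assumes S: "right_linear S" and c: "c < 1" and bound: "\<And>x. norm (S x) \<le> c * norm x"
  shows "bij (\<lambda>x. x + S x)"
proof -
  define c' where "c' = max c 0"
  have c': "0 \<le> c'" "c' < 1" and bound': "norm (S x) \<le> c' * norm x" for x
    using c order_trans[OF bound, of x "c' * norm x"] by (auto simp: c'_def mult_right_mono)
  have "\<exists>!x. y - S x = x" for y
  proof (rule banach_fix_type[OF c'], intro allI)
    fix a b
    have "dist (y - S a) (y - S b) = norm (S (b - a))"
      by (simp add: dist_norm right_linearD(5)[OF S])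
    then show "dist (y - S a) (y - S b) \<le> c' * dist a b"
      using bound'[of "b - a"] by (simp add: dist_norm norm_minus_commute)
  qed
  moreover have "x + S x = y \<longleftrightarrow> y - S x = x" for x y by (auto simp: algebra_simps)
  ultimately have "\<exists>!x. x + S x = y" for y by simp
  then show ?thesis by (simp add: bij_iff)
qed

text \<open>
  Project onto the span of a finite \<open>e\<close>-net of the image of the unit ball: the projection of
  \<open>K x\<close> is at least as close to \<open>K x\<close> as the nearest point of the net.
\<close>

lemma compact_operator_finite_rank_approximation:
  fixes K :: "'v::right_quat_hilbert \<Rightarrow> 'u::right_quat_hilbert"
  assumes K: "compact_operator K" and e: "e > 0"
  shows "\<exists>fs F. right_linear F \<and> range F \<subseteq> span_mod {0} fs \<and>
    (\<forall>x. norm (K x - F x) \<le> e * norm x)"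
proof -
  have Kl: "right_linear K" and comp: "compact (closure (K ` cball 0 1))"
    using K by (auto simp: compact_operator_def bounded_right_linear_iff)
  obtain N where N: "finite N" "closure (K ` cball 0 1) \<subseteq> (\<Union>y\<in>N. ball y e)"
    using seq_compact_imp_totally_bounded[OF comp[unfolded compact_eq_seq_compact_metric]] e by blast
  obtain fs where fs: "set fs = N" using finite_list[OF N(1)] by blast
  let ?W = "span_mod {0} fs"
  have W: "right_subspace ?W" by (rule right_subspace_span_mod[OF right_subspace_zero])
  obtain P where P: "orthogonal_projection P ?W" using orthogonal_projection_span_exists by blast
  have unit: "norm (K x - P (K x)) \<le> e" if "norm x \<le> 1" for x
  proof -
    have "K x \<in> closure (K ` cball 0 1)" using that closure_subset by fastforce
    then obtain y where "y \<in> set fs" "norm (K x - y) < e"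
      using N(2) fs by (auto simp: dist_norm norm_minus_commute)
    moreover from this have "y \<in> ?W" using set_subset_span_mod[OF right_subspace_zero] by blast
    ultimately show ?thesis using orthogonal_projection_closest[OF P W, of y "K x"] by simp
  qed
  have Pl: "right_linear P" and ran: "range P \<subseteq> ?W" using P by (auto simp: orthogonal_projection_def)
  have "norm (K x - P (K x)) \<le> e * norm x" for x
  proof (cases "x = 0")
    case False
    define r where "r = inverse (norm x)"
    have "norm (r *\<^sub>R (K x - P (K x))) \<le> e"
      using unit[of "r *\<^sub>R x"] False
      by (simp add: right_linear_scaleR[OF Kl] right_linear_scaleR[OF Pl] scaleR_diff_right r_def)
    then have "r * norm (K x - P (K x)) \<le> e" by (simp add: r_def)
    then show ?thesis using False by (simp add: r_def field_simps)
  qed (simp add: right_linearD(3)[OF Kl] right_linearD(3)[OF Pl])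
  moreover have "right_linear (\<lambda>x. P (K x))"
    by (rule right_linear_compose[OF Pl Kl])
  ultimately show ?thesis using ran by blast
qed

text \<open>
  Let \<open>P\<close> and \<open>Q\<close> be the projections onto \<open>ker T\<close> and onto a complement \<open>C\<close> of \<open>ran T\<close>. The map
  \<open>(v, u) \<mapsto> T v + Q u\<close> is onto, so each \<open>y\<close> is \<open>T v\<close> modulo \<open>C\<close> for some \<open>v\<close> bounded in
  terms of \<open>y\<close>. Replacing \<open>v\<close> by \<open>v - P v\<close> makes it unique, and uniqueness makes \<open>y \<mapsto> v\<close> linear.
\<close>

lemma bounded_parametrix:
  fixes T :: "'v::right_quat_hilbert \<Rightarrow> 'u::right_quat_hilbert"
  assumes T: "bounded_right_linear T" and ind: "has_index T n"
  shows "\<exists>B G cs C. right_linear B \<and> (\<forall>y. norm (B y) \<le> C * norm y) \<and>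
    right_linear G \<and> range G \<subseteq> span_mod {0} cs \<and> (\<forall>y. T (B y) = y - G y)"
proof -
  have Tl: "right_linear T" using T by (simp add: bounded_right_linear_iff)
  obtain ns cs where ns: "basis_mod (ker T) {0} ns" and cs: "basis_mod UNIV (range T) cs"
    using ind by (auto simp: has_index_def)
  let ?N = "span_mod {0} ns" and ?C = "span_mod {0} cs"
  have N: "right_subspace ?N" and C: "right_subspace ?C"
    by (simp_all add: right_subspace_span_mod right_subspace_zero)
  note TD = right_linearD[OF Tl] and CD = right_subspaceD[OF C]
  have NT: "?N = ker T"
    using basis_modD[OF ns] span_mod_least[OF right_subspace_ker[OF Tl] _ basis_modD(1)[OF ns]]
      right_subspaceD(1)[OF right_subspace_ker[OF Tl]] by blast
  obtain P where P: "orthogonal_projection P ?N" using orthogonal_projection_span_exists by blast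
  obtain Q where Q: "orthogonal_projection Q ?C" using orthogonal_projection_span_exists by blast
  have Pl: "right_linear P" and Ql: "right_linear Q" and Qran: "range Q \<subseteq> ?C" and Pran: "range P \<subseteq> ?N"
    using P Q by (auto simp: orthogonal_projection_def)
  note PD = right_linearD[OF Pl]
  have "bounded_right_linear Q"
    using Ql orthogonal_projection_bounded(2)[OF Q C] by (auto simp: bounded_right_linear_iff)
  then have "bounded_linear (\<lambda>p. T (fst p) + Q (snd p))"
    using T by (intro bounded_linear_add bounded_linear_compose[OF _ bounded_linear_fst]
        bounded_linear_compose[OF _ bounded_linear_snd] bounded_right_linear_imp_bounded_linear)
  moreover have "surj (\<lambda>p. T (fst p) + Q (snd p))"
    unfolding surj_def
  proof
    fix y
    obtain qs where "y - qcomb cs qs \<in> range T"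
      using basis_modD(3)[OF cs] unfolding span_mod_def by blast
    moreover have "qcomb cs qs \<in> ?C"
      by (rule qcomb_in_subspace[OF C set_subset_span_mod[OF right_subspace_zero]])
    then have "Q (qcomb cs qs) = qcomb cs qs" by (rule orthogonal_projection_fixes[OF Q C])
    ultimately obtain v where "T (fst (v, qcomb cs qs)) + Q (snd (v, qcomb cs qs)) = y"
      by (auto simp: algebra_simps)
    then show "\<exists>p. y = T (fst p) + Q (snd p)" by blast
  qed
  ultimately obtain M where M: "\<And>y. \<exists>p. T (fst p) + Q (snd p) = y \<and> norm p \<le> M * norm y"
    using surj_bounded_preimage by blast
  \<comment> \<open>The relation that determines \<open>B y\<close>; linearity of \<open>B\<close> comes from its uniqueness.\<close>
  define E where "E y v \<longleftrightarrow> y - T v \<in> ?C \<and> P v = 0" for y v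
  have "\<exists>v. E y v \<and> norm v \<le> M * norm y" for y
  proof -
    obtain v u where vu: "T v + Q u = y" "norm (v, u) \<le> M * norm y" using M[of y] by auto
    have "T (P v) = 0" using Pran NT by (auto simp: ker_def)
    moreover have "P (P v) = P v" using Pran by (intro orthogonal_projection_fixes[OF P N]) auto
    moreover have "y - T v \<in> ?C" using vu Qran by auto
    ultimately have "E y (v - P v)" by (simp add: E_def TD PD)
    moreover have "norm (v - P v) \<le> M * norm y"
      using orthogonal_projection_bounded(1)[OF P N, of v] vu(2)
        order_trans[OF norm_fst_le[of v u]] by force
    ultimately show ?thesis by blast
  qed
  then obtain B where B: "\<And>y. E y (B y)" "\<And>y. norm (B y) \<le> M * norm y" by metis
  have unique: "v = w" if "E y v" "E y w" for y v w
  proof -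
    have "(y - T w) - (y - T v) \<in> ?C"
      by (rule CD(5)) (use that in \<open>simp_all add: E_def\<close>)
    then obtain qs where qs: "length qs = length cs" "T (v - w) = qcomb cs qs"
      by (auto simp: span_mod_def TD)
    then have "\<forall>q\<in>set qs. q = 0"
      using independent_modD[OF basis_modD(2)[OF cs] qs(1)] by (metis rangeI)
    then have "qs = replicate (length qs) 0" by (metis replicate_length_same)
    then have "T (v - w) = 0" using qs(2) by (metis qcomb_zero)
    then have "P (v - w) = v - w"
      using NT by (intro orthogonal_projection_fixes[OF P N]) (simp add: ker_def)
    then show ?thesis using that by (simp add: E_def PD)
  qed
  have "E (x + y) (B x + B y)" for x y
    using CD(2)[of "x - T (B x)" "y - T (B y)"] B(1)[of x] B(1)[of y]
    by (simp add: E_def TD PD algebra_simps)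
  moreover have "E (x *\<^sub>Q q) (B x *\<^sub>Q q)" for x q
    using CD(3)[of "x - T (B x)" q] B(1)[of x] by (simp add: E_def TD PD scaleQ_diff_left)
  ultimately have Bl: "right_linear B"
    using unique B(1) unfolding right_linear_def by blast
  define G where "G y = y - T (B y)" for y
  have "right_linear G"
    by (simp add: right_linear_def G_def right_linearD[OF Bl] TD scaleQ_diff_left)
  moreover have "range G \<subseteq> ?C" using B(1) by (auto simp: G_def E_def)
  moreover have "T (B y) = y - G y" for y by (simp add: G_def)
  ultimately show ?thesis using Bl B(2) by blast
qed

text \<open>The decomposition \<open>A + K = A (1 + B S) + (G S + F)\<close>.\<close>

lemma has_index_compact_perturbation:
  fixes A K :: "'v::right_quat_hilbert \<Rightarrow> 'u::right_quat_hilbert"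
  assumes A: "bounded_right_linear A" and K: "compact_operator K" and ind: "has_index A n"
  shows "has_index (\<lambda>x. A x + K x) n"
proof -
  have Al: "right_linear A" and Kl: "right_linear K"
    using A K by (auto simp: bounded_right_linear_iff compact_operator_def)
  obtain B G cs C where Bl: "right_linear B" and Bb: "\<And>y. norm (B y) \<le> C * norm y"
    and Gl: "right_linear G" and Gr: "range G \<subseteq> span_mod {0} cs"
    and AB: "\<And>y. A (B y) = y - G y"
    using bounded_parametrix[OF A ind] by blast
  \<comment> \<open>Any \<open>e > 0\<close> with \<open>\<bar>C\<bar> * e < 1\<close> makes \<open>B S\<close> a contraction; adding \<open>1\<close> covers \<open>C = 0\<close>.\<close>
  define e where "e = 1 / (2 * (\<bar>C\<bar> + 1))"
  have e: "e > 0" "\<bar>C\<bar> * e < 1" by (auto simp: e_def field_simps)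
  obtain fs F where Fl: "right_linear F" and Fr: "range F \<subseteq> span_mod {0} fs"
    and near: "\<And>x. norm (K x - F x) \<le> e * norm x"
    using compact_operator_finite_rank_approximation[OF K e(1)] by blast
  define S where "S x = K x - F x" for x
  have Sl: "right_linear S"
    by (simp add: right_linear_def S_def right_linearD[OF Kl] right_linearD[OF Fl] scaleQ_diff_left)
  have BSl: "right_linear (\<lambda>x. B (S x))" and GSl: "right_linear (\<lambda>x. G (S x))"
    by (rule right_linear_compose[OF Bl Sl], rule right_linear_compose[OF Gl Sl])
  have "norm (B (S x)) \<le> \<bar>C\<bar> * e * norm x" for x
  proof -
    have "norm (B (S x)) \<le> C * norm (S x)" by (rule Bb)
    also have "\<dots> \<le> \<bar>C\<bar> * norm (S x)" by (intro mult_right_mono) auto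
    also have "\<dots> \<le> \<bar>C\<bar> * (e * norm x)" using near[of x] by (intro mult_left_mono) (auto simp: S_def)
    finally show ?thesis by (simp add: mult.assoc)
  qed
  then have bij: "bij (\<lambda>x. x + B (S x))" by (rule bij_id_plus_contraction[OF BSl e(2)])
  have Jl: "right_linear (\<lambda>x. x + B (S x))"
    by (rule right_linear_add[OF _ BSl]) (simp add: right_linear_def)
  have 1: "has_index (\<lambda>x. A (x + B (S x))) n" by (rule has_index_comp_bij[OF Al Jl bij ind])
  have AJl: "right_linear (\<lambda>x. A (x + B (S x)))"
    by (rule right_linear_compose[OF Al Jl])
  let ?W = "span_mod {0} (cs @ fs)"
  have W: "right_subspace ?W" by (rule right_subspace_span_mod[OF right_subspace_zero])
  have "set (cs @ fs) \<subseteq> ?W" by (rule set_subset_span_mod[OF right_subspace_zero])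
  then have "span_mod {0} cs \<subseteq> ?W" "span_mod {0} fs \<subseteq> ?W"
    using right_subspaceD(1)[OF W] by (simp_all add: span_mod_least[OF W])
  then have "G y \<in> ?W" "F x \<in> ?W" for x y using Gr Fr by blast+
  then have "range (\<lambda>x. G (S x) + F x) \<subseteq> ?W"
    using right_subspaceD(2)[OF W] by blast
  from has_index_finite_rank_perturbation[OF AJl right_linear_add[OF GSl Fl] this 1]
  show ?thesis by (simp add: right_linearD(1)[OF Al] AB S_def)
qed

section \<open>Kernel and cokernel as subquotients\<close>

lemma (in right_quat_space) lincomb_Nil [simp]: "lincomb [] qs = zero" "lincomb vs [] = zero"
  and lincomb_Cons [simp]: "lincomb (v # vs) (q # qs) = add (scale v q) (lincomb vs qs)"
  by (simp_all add: lincomb_def)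

lemma (in right_quat_space) dim_eqI:
  assumes "basis vs" and "\<And>us. basis us \<Longrightarrow> length us = length vs"
  shows "dim = length vs"
  unfolding dim_def
proof (rule the_equality)
  show "\<exists>us. basis us \<and> length us = length vs" using assms(1) by blast
  show "n = length vs" if "\<exists>us. basis us \<and> length us = n" for n
    using that assms(2) by blast
qed

lemma basis_ker_iff:
  assumes A: "bounded_right_linear A"
  shows "right_quat_space.basis (ker A) (+) 0 (*\<^sub>Q) vs \<longleftrightarrow> basis_mod (ker A) {0} vs"
proof -
  interpret right_quat_space "ker A" "(+)" 0 "(*\<^sub>Q)" by (rule right_quat_space_ker[OF A])
  have lin: "right_linear A" using A by (simp add: bounded_right_linear_iff)
  have comb: "lincomb vs qs = qcomb vs qs" for qs by (simp add: lincomb_def qcomb_def)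
  have "independent vs \<longleftrightarrow> independent_mod {0} vs"
    unfolding independent_def independent_mod_def comb by simp
  moreover have "span vs = span_mod {0} vs"
    unfolding span_def span_mod_def comb by auto
  ultimately show ?thesis
    unfolding basis_def basis_mod_def
    using span_mod_least[OF right_subspace_ker[OF lin], of "{0}" vs] zero_closed by auto
qed

lemma quot_class_eq_iff:
  assumes W: "right_subspace W"
  shows "quot_rel W `` {x} = quot_rel W `` {y} \<longleftrightarrow> x - y \<in> W"
proof
  assume "quot_rel W `` {x} = quot_rel W `` {y}"
  moreover have "y \<in> quot_rel W `` {y}" by (simp add: quot_rel_def right_subspaceD(1)[OF W])
  ultimately have "y \<in> quot_rel W `` {x}" by simp
  then show "x - y \<in> W" by (simp add: quot_rel_def)
next
  assume xy: "x - y \<in> W"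
  have "x - z \<in> W \<longleftrightarrow> y - z \<in> W" for z
    using right_subspaceD(2)[OF W xy, of "y - z"] right_subspaceD(5)[OF W _ xy, of "x - z"] by auto
  then show "quot_rel W `` {x} = quot_rel W `` {y}" by (simp add: quot_rel_def)
qed

lemma quot_class_ops:
  assumes W: "right_subspace W"
  shows "quot_add W (quot_rel W `` {x}) (quot_rel W `` {y}) = quot_rel W `` {x + y}"
    and "quot_scale W (quot_rel W `` {x}) q = quot_rel W `` {x *\<^sub>Q q}"
proof -
  have mem: "z \<in> quot_rel W `` {x} \<longleftrightarrow> x - z \<in> W" for x z by (simp add: quot_rel_def)
  have self: "z \<in> quot_rel W `` {z}" for z unfolding mem by (simp add: right_subspaceD(1)[OF W])
  have "quot_rel W `` {x' + y'} = quot_rel W `` {x + y}"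
    if "x' \<in> quot_rel W `` {x}" "y' \<in> quot_rel W `` {y}" for x' y'
  proof -
    have "(x - x') + (y - y') \<in> W" using that unfolding mem by (rule right_subspaceD(2)[OF W])
    then have "quot_rel W `` {x + y} = quot_rel W `` {x' + y'}"
      unfolding quot_class_eq_iff[OF W] by (simp add: algebra_simps)
    then show ?thesis by simp
  qed
  then show "quot_add W (quot_rel W `` {x}) (quot_rel W `` {y}) = quot_rel W `` {x + y}"
    unfolding quot_add_def using self[of x] self[of y] by blast
  have "quot_rel W `` {x' *\<^sub>Q q} = quot_rel W `` {x *\<^sub>Q q}" if "x' \<in> quot_rel W `` {x}" for x'
  proof -
    have "(x - x') *\<^sub>Q q \<in> W" using that unfolding mem by (rule right_subspaceD(3)[OF W])
    then have "quot_rel W `` {x *\<^sub>Q q} = quot_rel W `` {x' *\<^sub>Q q}"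
      unfolding quot_class_eq_iff[OF W] by (simp add: scaleQ_diff_left)
    then show ?thesis by simp
  qed
  then show "quot_scale W (quot_rel W `` {x}) q = quot_rel W `` {x *\<^sub>Q q}"
    unfolding quot_scale_def using self[of x] by blast
qed

text \<open>
  Bases of the cokernel correspond to lists of representatives that are bases modulo the range,
  since taking classes commutes with linear combinations.
\<close>

lemma basis_coker_iff:
  assumes A: "bounded_right_linear A"
  shows "right_quat_space.basis (quot_carrier (range A)) (quot_add (range A)) (quot_zero (range A))
      (quot_scale (range A)) (map (\<lambda>x. quot_rel (range A) `` {x}) vs) \<longleftrightarrow>
    basis_mod UNIV (range A) vs"
proof -
  let ?W = "range A" and ?c = "\<lambda>x. quot_rel (range A) `` {x}"
  interpret right_quat_space "quot_carrier ?W" "quot_add ?W" "quot_zero ?W" "quot_scale ?W"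
    by (rule right_quat_space_coker[OF A])
  have W: "right_subspace ?W"
    using A by (intro right_subspace_range) (simp add: bounded_right_linear_iff)
  have comb: "lincomb (map ?c us) qs = ?c (qcomb us qs)" for us qs
    by (induction us arbitrary: qs; (case_tac qs)?)
      (simp_all add: quot_class_ops[OF W] flip: quot_zero_def)
  have car: "quot_carrier ?W = range ?c"
    by (auto simp: quot_carrier_def quotient_def)
  have "independent (map ?c vs) \<longleftrightarrow> independent_mod ?W vs"
    unfolding independent_def independent_mod_def comb
    by (simp add: quot_zero_def quot_class_eq_iff[OF W])
  moreover have "span (map ?c vs) = quot_carrier ?W \<longleftrightarrow> UNIV \<subseteq> span_mod ?W vs"
  proof -
    have "span (map ?c vs) \<subseteq> quot_carrier ?W"
      unfolding span_def comb car by auto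
    moreover have "?c w \<in> span (map ?c vs) \<longleftrightarrow> w \<in> span_mod ?W vs" for w
      unfolding span_def comb span_mod_def mem_Collect_eq quot_class_eq_iff[OF W] by auto
    ultimately show ?thesis unfolding car by blast
  qed
  moreover have "set (map ?c vs) \<subseteq> quot_carrier ?W" unfolding car by auto
  ultimately show ?thesis unfolding basis_def basis_mod_def by simp
qed

lemma basis_coker_imp_classes:
  assumes A: "bounded_right_linear A"
    and Xs: "right_quat_space.basis (quot_carrier (range A)) (quot_add (range A))
      (quot_zero (range A)) (quot_scale (range A)) Xs"
  obtains vs where "Xs = map (\<lambda>x. quot_rel (range A) `` {x}) vs"
proof -
  interpret right_quat_space "quot_carrier (range A)" "quot_add (range A)" "quot_zero (range A)"
      "quot_scale (range A)"
    by (rule right_quat_space_coker[OF A])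
  have sub: "set Xs \<subseteq> range (\<lambda>x. quot_rel (range A) `` {x})"
    using Xs unfolding basis_def by (auto simp: quot_carrier_def quotient_def)
  show ?thesis using list_in_image_lift[OF sub] that by auto
qed

text \<open>
  The bridge between \<open>has_index\<close> and the Fredholm index. The dimensions there are definite
  descriptions, which are well defined by \<open>basis_mod_length_unique\<close>.
\<close>

lemma fredholm_index_eq_iff:
  assumes A: "bounded_right_linear A"
  shows "fredholm A \<and> fredholm_index A = n \<longleftrightarrow> has_index A n"
proof -
  let ?c = "\<lambda>x. quot_rel (range A) `` {x}"
  interpret k: right_quat_space "ker A" "(+)" 0 "(*\<^sub>Q)" by (rule right_quat_space_ker[OF A])
  interpret c: right_quat_space "quot_carrier (range A)" "quot_add (range A)" "quot_zero (range A)"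
      "quot_scale (range A)"
    by (rule right_quat_space_coker[OF A])
  have R: "right_subspace (range A)"
    using A by (intro right_subspace_range) (simp add: bounded_right_linear_iff)
  have dk: "dim_ker A = length us" if us: "basis_mod (ker A) {0} us" for us
    unfolding dim_ker_def
    by (rule k.dim_eqI)
      (use us basis_mod_length_unique[OF right_subspace_zero] in \<open>auto simp: basis_ker_iff[OF A]\<close>)
  have dc: "dim_coker A = length vs" if vs: "basis_mod UNIV (range A) vs" for vs
  proof -
    have "c.dim = length (map ?c vs)"
    proof (rule c.dim_eqI)
      show "c.basis (map ?c vs)" using vs by (simp only: basis_coker_iff[OF A])
      fix Xs assume Xs: "c.basis Xs"
      then obtain ws where ws: "Xs = map ?c ws" by (rule basis_coker_imp_classes[OF A])
      then have "basis_mod UNIV (range A) ws" using Xs by (simp only: basis_coker_iff[OF A])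
      then show "length Xs = length (map ?c vs)"
        using basis_mod_length_unique[OF R _ vs] by (simp add: ws)
    qed
    then show ?thesis by (simp add: dim_coker_def)
  qed
  have fk: "ker_finite_dimensional A \<longleftrightarrow> (\<exists>us. basis_mod (ker A) {0} us)"
    by (simp add: ker_finite_dimensional_def k.finite_dimensional_def basis_ker_iff[OF A])
  have fc: "coker_finite_dimensional A \<longleftrightarrow> (\<exists>vs. basis_mod UNIV (range A) vs)"
    unfolding coker_finite_dimensional_def c.finite_dimensional_def
    using basis_coker_iff[OF A] basis_coker_imp_classes[OF A] by auto blast
  show ?thesis
    unfolding fredholm_def fk fc has_index_def fredholm_index_def
    using A by (auto simp: dk dc) blast
qed

lemma bounded_right_linear_add:
  assumes "bounded_right_linear A" "bounded_right_linear B"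
  shows "bounded_right_linear (\<lambda>x. A x + B x)"
proof -
  obtain C D where C: "\<And>x. norm (A x) \<le> C * norm x" and D: "\<And>x. norm (B x) \<le> D * norm x"
    using assms by (auto simp: bounded_right_linear_iff)
  have "norm (A x + B x) \<le> (C + D) * norm x" for x
    using norm_triangle_le[OF add_mono[OF C D], of x x] by (simp add: distrib_right)
  then show ?thesis using assms by (auto simp: bounded_right_linear_iff right_linear_add)
qed

theorem theorem6p16:
  fixes A K :: "'v::right_quat_hilbert \<Rightarrow> 'u::right_quat_hilbert"
  assumes "separable_space (euclidean :: 'v topology)"
    and "separable_space (euclidean :: 'u topology)"
    and "fredholm A"
    and "compact_operator K"
  shows "fredholm (\<lambda>x. A x + K x) \<and> fredholm_index (\<lambda>x. A x + K x) = fredholm_index A"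
proof -
  have A: "bounded_right_linear A" using assms(3) by (simp add: fredholm_def)
  have "bounded_right_linear K" using assms(4) by (simp add: compact_operator_def)
  then have AK: "bounded_right_linear (\<lambda>x. A x + K x)" by (rule bounded_right_linear_add[OF A])
  have "has_index A (fredholm_index A)"
    using fredholm_index_eq_iff[OF A] assms(3) by blast
  then have "has_index (\<lambda>x. A x + K x) (fredholm_index A)"
    by (rule has_index_compact_perturbation[OF A assms(4)])
  then show ?thesis using fredholm_index_eq_iff[OF AK] by blast
qed

end
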